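(* Let $T$, $\mathcal{S}=\mathcal{S}_+\cup\mathcal{S}_-$, $\Psi$, $\lambda,\mu$, $P_\lambda,P_\mu$ and $E,F,G,H$ be as in the context, and let $R_1:=E(I-\Psi H)^{-1}$. Let $$C'_{-1}=\frac12\begin{bmatrix}0&P_{\mu+-}\\0&P_{\mu--}\end{bmatrix},\quad C'_0=\frac12\begin{bmatrix}P_{\mu++}&P_{\lambda+-}\\P_{\mu-+}&P_{\lambda--}\end{bmatrix},\quad C'_1=\frac12\begin{bmatrix}P_{\lambda++}&0\\P_{\lambda-+}&0\end{bmatrix},$$ and let $\mathcal{R}_{C'}$ be the minimal nonnegative solution of $\mathcal{R}^2C'_{-1}+\mathcal{R}C'_0+C'_1=\mathcal{R}$ (the expected-number-of-visits matrix of the QBD with these transition blocks). Then $$\mathcal{R}_{C'}=(I-C'_0)\begin{bmatrix}E&0\\H&0\end{bmatrix}\begin{bmatrix}I&R_1\Psi\\0&(I-H\Psi)^{-1}\end{bmatrix}(I-C'_0)^{-1},$$ and the spectral radius of $\mathcal{R}_{C'}$ equals $\rho(R_1)$.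
   Context: $T$ is the generator of a continuous-time Markov chain on a finite set $\mathcal{S}=\mathcal{S}_+\cup\mathcal{S}_-$ (disjoint, both nonempty), partitioned into blocks $T_{++},T_{+-},T_{-+},T_{--}$ according to $\mathcal{S}_\pm$. $\Psi$ is the minimal nonnegative solution of $T_{+-}+\Psi T_{--}+T_{++}\Psi+\Psi T_{-+}\Psi=0$ (the first-return probability matrix of the unit-rate fluid queue with phase generator $T$, rates $+1$ on $\mathcal{S}_+$ and $-1$ on $\mathcal{S}_-$). $\lambda,\mu>0$ satisfy $\lambda,\mu\ge\max_i|T_{ii}|$; $P_\lambda:=I+\lambda^{-1}T$, $P_\mu:=I+\mu^{-1}T$ with blocks $P_{\lambda++}$ etc. The matrices $E,G,H,F$ are defined by $\begin{bmatrix}E&G\\H&F\end{bmatrix}=\begin{bmatrix}I-\mu^{-1}T_{++}&-\lambda^{-1}T_{+-}\\-\mu^{-1}T_{-+}&I-\lambda^{-1}T_{--}\end{bmatrix}^{-1}\begin{bmatrix}I+\lambda^{-1}T_{++}&\mu^{-1}T_{+-}\\\lambda^{-1}T_{-+}&I+\mu^{-1}T_{--}\end{bmatrix}$, with $E$ of size $|\mathcal{S}_+|\times|\mathcal{S}_+|$ and $F$ of size $|\mathcal{S}_-|\times|\mathcal{S}_-|$. $\rho(\cdot)$ denotes spectral radius. *)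

theory Defs
  imports "Jordan_Normal_Form.Spectral_Radius"
begin

definition generator_mat :: "nat \<Rightarrow> real mat \<Rightarrow> bool" where
  "generator_mat n T \<longleftrightarrow> T \<in> carrier_mat n n \<and>
     (\<forall>i<n. \<forall>j<n. i \<noteq> j \<longrightarrow> T $$ (i,j) \<ge> 0) \<and>
     (\<forall>i<n. (\<Sum>j<n. T $$ (i,j)) = 0)"

definition mat_le :: "real mat \<Rightarrow> real mat \<Rightarrow> bool" where
  "mat_le A B \<longleftrightarrow> (\<forall>i<dim_row A. \<forall>j<dim_col A. A $$ (i,j) \<le> B $$ (i,j))"

definition nonneg_mat :: "real mat \<Rightarrow> bool" where
  "nonneg_mat A \<longleftrightarrow> (\<forall>i<dim_row A. \<forall>j<dim_col A. A $$ (i,j) \<ge> 0)"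

definition min_nonneg_sol :: "nat \<Rightarrow> nat \<Rightarrow> (real mat \<Rightarrow> bool) \<Rightarrow> real mat \<Rightarrow> bool" where
  "min_nonneg_sol r c P X \<longleftrightarrow> X \<in> carrier_mat r c \<and> nonneg_mat X \<and> P X \<and>
     (\<forall>Y. Y \<in> carrier_mat r c \<and> nonneg_mat Y \<and> P Y \<longrightarrow> mat_le X Y)"

text \<open>Matrix inverse of a square matrix (unspecified if the matrix is singular).\<close>
definition minv :: "real mat \<Rightarrow> real mat" where
  "minv A = (SOME B. B \<in> carrier_mat (dim_row A) (dim_row A) \<and>
      A * B = 1\<^sub>m (dim_row A) \<and> B * A = 1\<^sub>m (dim_row A))"

end

theory Submission
  imports Defs
begin

text \<open>
  With \<open>D = diag (mu\<inverse>, lam\<inverse>)\<close> one has \<open>2 (I - C\<^sub>0) = I - T D\<close>, so left multiplication by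
  \<open>(I - C\<^sub>0)\<inverse>\<close> turns \<open>C\<^sub>1\<close> and \<open>C\<^sub>-\<^sub>1\<close> into \<open>[E 0; H 0]\<close> and \<open>[0 G; 0 F]\<close>. The matrix equation
  \<open>W = C\<^sub>1 W\<^sup>2 + C\<^sub>0 W + C\<^sub>-\<^sub>1\<close> thereby has solutions \<open>W = [0 X; 0 Z]\<close>, and eliminating \<open>Z\<close> shows
  that \<open>X\<close> solves the Riccati equation; conversely \<open>X = \<Psi>\<close> gives a solution \<open>W\<close>. The matrix
  \<open>R = C\<^sub>1 (I - C\<^sub>0 - C\<^sub>1 W)\<inverse>\<close> built from it is the right-hand side of the claim and solves the
  \<open>R\<close>-equation. The minimal solution lies below it and yields in the same way a solution of the
  Riccati equation below \<open>\<Psi>\<close>, so the two agree. Finally \<open>R\<close> is a product of the form \<open>(K P) (Q K\<inverse>)\<close>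
  with \<open>P = [E; H]\<close>, \<open>Q = [I, R\<^sub>1 \<Psi>]\<close> and \<open>Q P = R\<^sub>1\<close>.

  Since \<open>T\<close> may be reducible, the invertibility of \<open>I - H \<Psi>\<close> needs an argument: the row sums of
  \<open>H \<Psi>\<close> are strictly less than 1.
\<close>

subsection \<open>Matrix algebra\<close>

lemma mult_assoc_dim:
  "dim_col A = dim_row B \<Longrightarrow> dim_col B = dim_row C \<Longrightarrow> (A * B) * C = A * (B * C)"
  for A B C :: "'a::semiring_0 mat"
  by (rule assoc_mult_mat) auto

lemma add_mult_dim:
  "dim_row A = dim_row B \<Longrightarrow> dim_col A = dim_col B \<Longrightarrow> dim_col B = dim_row C \<Longrightarrow>
   (A + B) * C = A * C + B * C"
  for A B C :: "'a::semiring_0 mat"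
  by (rule add_mult_distrib_mat) auto

lemma mult_add_dim:
  "dim_row B = dim_row C \<Longrightarrow> dim_col B = dim_col C \<Longrightarrow> dim_col A = dim_row B \<Longrightarrow>
   A * (B + C) = A * B + A * C"
  for A B C :: "'a::semiring_0 mat"
  by (rule mult_add_distrib_mat) auto

lemma minus_mult_dim:
  "dim_row A = dim_row B \<Longrightarrow> dim_col A = dim_col B \<Longrightarrow> dim_col B = dim_row C \<Longrightarrow>
   (A - B) * C = A * C - B * C"
  for A B C :: "'a::ring mat"
  by (rule minus_mult_distrib_mat) auto

lemma mult_minus_dim:
  "dim_row B = dim_row C \<Longrightarrow> dim_col B = dim_col C \<Longrightarrow> dim_col A = dim_row B \<Longrightarrow>
   A * (B - C) = A * B - A * C"
  for A B C :: "'a::ring mat"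
  by (rule mult_minus_distrib_mat) auto

lemma smult_mult_dim:
  "dim_col A = dim_row B \<Longrightarrow> (k \<cdot>\<^sub>m A) * B = k \<cdot>\<^sub>m (A * B)"
  for A B :: "'a::comm_semiring_0 mat"
  by (rule mult_smult_assoc_mat) auto

lemma mult_smult_dim:
  "dim_col A = dim_row B \<Longrightarrow> A * (k \<cdot>\<^sub>m B) = k \<cdot>\<^sub>m (A * B)"
  for A B :: "'a::comm_semiring_0 mat"
  by (rule mult_smult_distrib) auto

lemma add_zero_dim:
  "dim_row A = r \<Longrightarrow> dim_col A = c \<Longrightarrow> A + 0\<^sub>m r c = A"
  "dim_row A = r \<Longrightarrow> dim_col A = c \<Longrightarrow> 0\<^sub>m r c + A = A"
  for A :: "'a::monoid_add mat"
  by (auto intro!: eq_matI)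

lemma smult_add_dim:
  "dim_row A = dim_row B \<Longrightarrow> dim_col A = dim_col B \<Longrightarrow> k \<cdot>\<^sub>m (A + B) = k \<cdot>\<^sub>m A + k \<cdot>\<^sub>m B"
  for A B :: "'a::semiring_0 mat"
  by (rule eq_matI) (auto simp: algebra_simps)

lemma smult_minus_dim:
  "dim_row A = dim_row B \<Longrightarrow> dim_col A = dim_col B \<Longrightarrow> k \<cdot>\<^sub>m (A - B) = k \<cdot>\<^sub>m A - k \<cdot>\<^sub>m B"
  for A B :: "'a::ring mat"
  by (rule eq_matI) (auto simp: algebra_simps)

lemma smult_smult_dim: "k \<cdot>\<^sub>m (l \<cdot>\<^sub>m A) = (k * l) \<cdot>\<^sub>m A"
  for A :: "'a::semigroup_mult mat"
  by (rule eq_matI) (auto simp: mult.assoc)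

text \<open>Expands products into sums of right-associated monomials; the side conditions speak about
  dimensions instead of carriers, so that the simplifier can discharge them without guessing sizes.\<close>

lemmas mat_expand = mult_assoc_dim add_mult_dim mult_add_dim minus_mult_dim mult_minus_dim
  smult_mult_dim mult_smult_dim add_zero_dim
  smult_add_dim smult_minus_dim smult_smult_dim

lemma uminus_zero_dim: "- (0\<^sub>m r c :: 'a::group_add mat) = 0\<^sub>m r c"
  by (rule eq_matI) auto

lemma mat_eq_iff_minus:
  fixes A B :: "'a::group_add mat"
  assumes "A \<in> carrier_mat r c" "B \<in> carrier_mat r c"
  shows "A = B \<longleftrightarrow> A - B = 0\<^sub>m r c"
proof
  assume 0: "A - B = 0\<^sub>m r c"
  show "A = B"
  proof (rule eq_matI)
    fix i j assume "i < dim_row B" "j < dim_col B"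
    then have ij: "i < r" "j < c" using assms by auto
    have "(A - B) $$ (i,j) = 0" using 0 ij by simp
    then show "A $$ (i,j) = B $$ (i,j)" using assms ij by simp
  qed (use assms in auto)
qed (use assms in auto)

lemma index_mult_sum:
  assumes "A \<in> carrier_mat r m" "B \<in> carrier_mat m c" "i < r" "j < c"
  shows "(A * B) $$ (i,j) = (\<Sum>k<m. A $$ (i,k) * B $$ (k,j))"
  using assms by (auto simp: scalar_prod_def atLeast0LessThan intro!: sum.cong)

lemma four_block_mat_eqD:
  assumes eq: "four_block_mat A B C D = four_block_mat A' B' C' D'"
    and c: "A \<in> carrier_mat r1 c1" "B \<in> carrier_mat r1 c2" "C \<in> carrier_mat r2 c1" "D \<in> carrier_mat r2 c2"
      "A' \<in> carrier_mat r1 c1" "B' \<in> carrier_mat r1 c2" "C' \<in> carrier_mat r2 c1" "D' \<in> carrier_mat r2 c2"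
  shows "A = A'" "B = B'" "C = C'" "D = D'"
proof -
  have e: "four_block_mat A B C D $$ (i,j) = four_block_mat A' B' C' D' $$ (i,j)" for i j
    using eq by simp
  show "A = A'"
  proof (rule eq_matI)
    fix i j assume "i < dim_row A'" "j < dim_col A'"
    then show "A $$ (i,j) = A' $$ (i,j)" using e[of i j] c by (auto dest!: carrier_matD)
  qed (use c in auto)
  show "B = B'"
  proof (rule eq_matI)
    fix i j assume "i < dim_row B'" "j < dim_col B'"
    then show "B $$ (i,j) = B' $$ (i,j)" using e[of i "c1 + j"] c by (auto dest!: carrier_matD)
  qed (use c in auto)
  show "C = C'"
  proof (rule eq_matI)
    fix i j assume "i < dim_row C'" "j < dim_col C'"
    then show "C $$ (i,j) = C' $$ (i,j)" using e[of "r1 + i" j] c by (auto dest!: carrier_matD)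
  qed (use c in auto)
  show "D = D'"
  proof (rule eq_matI)
    fix i j assume "i < dim_row D'" "j < dim_col D'"
    then show "D $$ (i,j) = D' $$ (i,j)" using e[of "r1 + i" "c1 + j"] c by (auto dest!: carrier_matD)
  qed (use c in auto)
qed

lemma minus_four_block_mat:
  assumes "A \<in> carrier_mat r1 c1" "B \<in> carrier_mat r1 c2" "C \<in> carrier_mat r2 c1" "D \<in> carrier_mat r2 c2"
      "A' \<in> carrier_mat r1 c1" "B' \<in> carrier_mat r1 c2" "C' \<in> carrier_mat r2 c1" "D' \<in> carrier_mat r2 c2"
  shows "four_block_mat A B C D - four_block_mat A' B' C' D'
    = four_block_mat (A - A') (B - B') (C - C') (D - D')"
  by (rule eq_matI) (use assms in auto)

text \<open>\<open>minv\<close> is a choice among inverses; since a two-sided inverse is unique,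
  exhibiting one determines its value.\<close>

lemma minv_eqI:
  assumes A: "A \<in> carrier_mat n n" and B: "B \<in> carrier_mat n n"
    and AB: "A * B = 1\<^sub>m n" and BA: "B * A = 1\<^sub>m n"
  shows "minv A = B"
  unfolding minv_def
proof (rule some_equality)
  show "B \<in> carrier_mat (dim_row A) (dim_row A) \<and> A * B = 1\<^sub>m (dim_row A) \<and> B * A = 1\<^sub>m (dim_row A)"
    using assms by auto
next
  fix C assume "C \<in> carrier_mat (dim_row A) (dim_row A) \<and> A * C = 1\<^sub>m (dim_row A) \<and> C * A = 1\<^sub>m (dim_row A)"
  then have C: "C \<in> carrier_mat n n" and CA: "C * A = 1\<^sub>m n" using A by auto
  have "C = C * (A * B)" using AB C by simp
  also have "\<dots> = (C * A) * B" using A B C by (simp add: mult_assoc_dim)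
  finally show "C = B" using CA B by simp
qed

subsection \<open>Nonnegative matrices and inverses of Z-matrices\<close>

lemma nonneg_mat_add:
  "nonneg_mat A \<Longrightarrow> nonneg_mat B \<Longrightarrow> dim_row A = dim_row B \<Longrightarrow> dim_col A = dim_col B \<Longrightarrow> nonneg_mat (A + B)"
  by (auto simp: nonneg_mat_def)

lemma nonneg_mat_smult: "nonneg_mat A \<Longrightarrow> 0 \<le> k \<Longrightarrow> nonneg_mat (k \<cdot>\<^sub>m A)"
  by (auto simp: nonneg_mat_def)

lemma nonneg_mat_mult:
  assumes "nonneg_mat A" "nonneg_mat B" "dim_col A = dim_row B"
  shows "nonneg_mat (A * B)"
  using assms by (auto simp: nonneg_mat_def scalar_prod_def intro!: sum_nonneg)

lemma nonneg_mat_one: "nonneg_mat (1\<^sub>m n)"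
  by (auto simp: nonneg_mat_def)

lemma nonneg_mat_zero: "nonneg_mat (0\<^sub>m r c)"
  by (auto simp: nonneg_mat_def)

lemma nonneg_mat_four_block:
  assumes c: "A \<in> carrier_mat r1 c1" "B \<in> carrier_mat r1 c2" "C \<in> carrier_mat r2 c1" "D \<in> carrier_mat r2 c2"
  shows "nonneg_mat (four_block_mat A B C D) \<longleftrightarrow>
    nonneg_mat A \<and> nonneg_mat B \<and> nonneg_mat C \<and> nonneg_mat D" (is "nonneg_mat ?S \<longleftrightarrow> _")
proof
  assume S: "nonneg_mat ?S"
  have e: "0 \<le> ?S $$ (i,j)" if "i < r1 + r2" "j < c1 + c2" for i j
    using S that c by (auto simp: nonneg_mat_def)
  have "0 \<le> A $$ (i,j)" if "i < r1" "j < c1" for i j using e[of i j] that c by auto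
  moreover have "0 \<le> B $$ (i,j)" if "i < r1" "j < c2" for i j using e[of i "c1 + j"] that c by auto
  moreover have "0 \<le> C $$ (i,j)" if "i < r2" "j < c1" for i j using e[of "r1 + i" j] that c by auto
  moreover have "0 \<le> D $$ (i,j)" if "i < r2" "j < c2" for i j using e[of "r1 + i" "c1 + j"] that c by auto
  ultimately show "nonneg_mat A \<and> nonneg_mat B \<and> nonneg_mat C \<and> nonneg_mat D"
    using c by (auto simp: nonneg_mat_def)
qed (use c in \<open>auto simp: nonneg_mat_def\<close>)

lemma mat_le_iff_nonneg:
  "dim_row A = dim_row B \<Longrightarrow> dim_col A = dim_col B \<Longrightarrow> mat_le A B \<longleftrightarrow> nonneg_mat (B - A)"
  by (auto simp: mat_le_def nonneg_mat_def)

lemma mat_le_antisym: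
  "mat_le A B \<Longrightarrow> mat_le B A \<Longrightarrow> dim_row A = dim_row B \<Longrightarrow> dim_col A = dim_col B \<Longrightarrow> A = B"
  by (rule eq_matI) (auto simp: mat_le_def intro: antisym)

section \<open>Row sums, that is, products with the all-ones vector\<close>

definition row_sum :: "real mat \<Rightarrow> nat \<Rightarrow> real" where
  "row_sum A i = (\<Sum>j<dim_col A. A $$ (i,j))"

lemma row_sum_mult:
  assumes "A \<in> carrier_mat r m" "B \<in> carrier_mat m c" "i < r"
  shows "row_sum (A * B) i = (\<Sum>k<m. A $$ (i,k) * row_sum B k)"
proof -
  have "row_sum (A * B) i = (\<Sum>j<c. \<Sum>k<m. A $$ (i,k) * B $$ (k,j))"
    unfolding row_sum_def using assms by (auto intro!: sum.cong simp: index_mult_sum[of A r m B c] simp del: index_mult_mat(1))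
  also have "\<dots> = (\<Sum>k<m. A $$ (i,k) * row_sum B k)"
    unfolding row_sum_def using assms by (subst sum.swap) (simp add: sum_distrib_left)
  finally show ?thesis .
qed

lemma row_sum_add:
  assumes "dim_row A = dim_row B" "dim_col A = dim_col B" "i < dim_row B"
  shows "row_sum (A + B) i = row_sum A i + row_sum B i"
  using assms by (auto simp: row_sum_def sum.distrib)

lemma row_sum_minus:
  assumes "dim_row A = dim_row B" "dim_col A = dim_col B" "i < dim_row B"
  shows "row_sum (A - B) i = row_sum A i - row_sum B i"
  using assms by (auto simp: row_sum_def sum_subtractf)

lemma row_sum_smult:
  assumes "i < dim_row A"
  shows "row_sum (k \<cdot>\<^sub>m A) i = k * row_sum A i"
  using assms by (auto simp: row_sum_def sum_distrib_left)

lemma row_sum_one: "i < n \<Longrightarrow> row_sum (1\<^sub>m n) i = 1"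
  by (auto simp: row_sum_def)

lemma row_sum_four_block:
  assumes c: "A \<in> carrier_mat r1 c1" "B \<in> carrier_mat r1 c2" "C \<in> carrier_mat r2 c1" "D \<in> carrier_mat r2 c2"
  shows "i < r1 \<Longrightarrow> row_sum (four_block_mat A B C D) i = row_sum A i + row_sum B i"
    and "i < r2 \<Longrightarrow> row_sum (four_block_mat A B C D) (r1 + i) = row_sum C i + row_sum D i"
proof -
  have split: "(\<Sum>j<c1 + c2. f j) = (\<Sum>j<c1. f j) + (\<Sum>j<c2. f (c1 + j))" for f :: "nat \<Rightarrow> real"
    by (induction c2) auto
  show "i < r1 \<Longrightarrow> row_sum (four_block_mat A B C D) i = row_sum A i + row_sum B i"
    using c by (auto simp: row_sum_def split)
  show "i < r2 \<Longrightarrow> row_sum (four_block_mat A B C D) (r1 + i) = row_sum C i + row_sum D i"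
    using c by (auto simp: row_sum_def split)
qed

text \<open>A sign-reversed off-diagonal turns \<open>A x \<ge> 0\<close> into \<open>x \<ge> 0\<close>: look at an index minimising
  \<open>x i / v i\<close>.\<close>

lemma Z_matrix_monotone:
  fixes v x :: "nat \<Rightarrow> real"
  assumes off: "\<And>i j. i < n \<Longrightarrow> j < n \<Longrightarrow> i \<noteq> j \<Longrightarrow> A $$ (i,j) \<le> 0"
    and v: "\<And>i. i < n \<Longrightarrow> 0 < v i"
    and Av: "\<And>i. i < n \<Longrightarrow> 0 < (\<Sum>j<n. A $$ (i,j) * v j)"
    and Ax: "\<And>i. i < n \<Longrightarrow> 0 \<le> (\<Sum>j<n. A $$ (i,j) * x j)"
    and k: "k < n"
  shows "0 \<le> x k"
proof (rule ccontr)
  assume neg: "\<not> 0 \<le> x k"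
  define t where "t = Min ((\<lambda>i. x i / v i) ` {..<n})"
  have "t \<in> (\<lambda>i. x i / v i) ` {..<n}" unfolding t_def using k by (intro Min_in) auto
  then obtain i where i: "i < n" "t = x i / v i" by auto
  have min: "t \<le> x j / v j" if "j < n" for j unfolding t_def using that by (intro Min_le) auto
  have "x k / v k < 0" using neg v[OF k] by (simp add: divide_neg_pos)
  then have t: "t < 0" using min[OF k] by simp
  \<comment> \<open>At the minimiser \<open>i\<close> the diagonal terms agree, and elsewhere a
    nonpositive entry reverses \<open>t * v j \<le> x j\<close>; summing gives
    \<open>(A x) i \<le> t (A v) i < 0\<close>.\<close>
  have "A $$ (i,j) * x j \<le> A $$ (i,j) * (t * v j)" if j: "j < n" for j
  proof (cases "j = i")
    case True
    then show ?thesis using i v[OF i(1)] by simp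
  next
    case False
    have "t * v j \<le> x j" using min[OF j] v[OF j] by (simp add: field_simps)
    then show ?thesis using off[OF i(1) j] False by (intro mult_left_mono_neg) auto
  qed
  then have "(\<Sum>j<n. A $$ (i,j) * x j) \<le> (\<Sum>j<n. A $$ (i,j) * (t * v j))" by (intro sum_mono) auto
  also have "\<dots> = t * (\<Sum>j<n. A $$ (i,j) * v j)" by (simp add: sum_distrib_left algebra_simps)
  also have "\<dots> < 0" using t Av[OF i(1)] by (simp add: mult_neg_pos)
  finally show False using Ax[OF i(1)] by simp
qed

text \<open>Monotonicity applied to a kernel vector and to its negative shows that the kernel is
  trivial; applied to each column of the inverse, whose image is a unit vector, it gives
  nonnegativity.\<close>

lemma Z_matrix_nonneg_inverse:
  fixes v :: "nat \<Rightarrow> real"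
  assumes A: "A \<in> carrier_mat n n"
    and off: "\<And>i j. i < n \<Longrightarrow> j < n \<Longrightarrow> i \<noteq> j \<Longrightarrow> A $$ (i,j) \<le> 0"
    and v: "\<And>i. i < n \<Longrightarrow> 0 < v i"
    and Av: "\<And>i. i < n \<Longrightarrow> 0 < (\<Sum>j<n. A $$ (i,j) * v j)"
  obtains B where "B \<in> carrier_mat n n" "A * B = 1\<^sub>m n" "B * A = 1\<^sub>m n" "nonneg_mat B"
proof -
  have Avec: "(A *\<^sub>v x) $ i = (\<Sum>j<n. A $$ (i,j) * x $ j)" if "x \<in> carrier_vec n" "i < n" for x i
    using that A by (auto simp: scalar_prod_def atLeast0LessThan intro!: sum.cong)
  have "det A \<noteq> 0"
  proof
    assume "det A = 0"
    then obtain x where x: "x \<in> carrier_vec n" "x \<noteq> 0\<^sub>v n" "A *\<^sub>v x = 0\<^sub>v n"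
      using det_0_iff_vec_prod_zero_field[OF A] by auto
    have s: "(\<Sum>j<n. A $$ (i,j) * x $ j) = 0" if "i < n" for i
      using Avec[OF x(1) that] x(3) that by simp
    have "x $ k = 0" if k: "k < n" for k
    proof -
      have "0 \<le> x $ k"
        by (rule Z_matrix_monotone[of n A v, OF off v Av]) (use s k in auto)
      moreover have "0 \<le> - x $ k"
        by (rule Z_matrix_monotone[of n A v "\<lambda>k. - x $ k", OF off v Av])
          (use s k in \<open>auto simp: sum_negf\<close>)
      ultimately show ?thesis by simp
    qed
    then show False using x by auto
  qed
  from det_non_zero_imp_unit[OF A this] obtain B
    where B: "B \<in> carrier_mat n n" "A * B = 1\<^sub>m n" "B * A = 1\<^sub>m n"
    by (auto simp: Units_def ring_mat_def)
  have "0 \<le> B $$ (k,j)" if k: "k < n" and j: "j < n" for k j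
  proof (rule Z_matrix_monotone[of n A v "\<lambda>k. B $$ (k,j)", OF off v Av])
    fix i assume i: "i < n"
    have "(\<Sum>k<n. A $$ (i,k) * B $$ (k,j)) = (1\<^sub>m n :: real mat) $$ (i,j)"
      using index_mult_sum[OF A B(1) i j] B(2) by simp
    then show "0 \<le> (\<Sum>k<n. A $$ (i,k) * B $$ (k,j))" using i j by simp
  qed (use k in auto)
  then have "nonneg_mat B" using B(1) by (auto simp: nonneg_mat_def)
  then show thesis using that B by blast
qed

subsection \<open>Spectral radius of a product\<close>

text \<open>\<open>Q\<close> carries an eigenvector of \<open>P * Q\<close> to one of
  \<open>Q * P\<close>; a nonzero eigenvalue ensures that the image is not zero.\<close>

lemma eigenvalue_mult_commute:
  fixes P Q :: "'a::field mat"
  assumes P: "P \<in> carrier_mat n m" and Q: "Q \<in> carrier_mat m n"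
    and ev: "eigenvalue (P * Q) k" and k: "k \<noteq> 0"
  shows "eigenvalue (Q * P) k"
proof -
  from ev obtain x where x: "x \<in> carrier_vec n" "x \<noteq> 0\<^sub>v n" "(P * Q) *\<^sub>v x = k \<cdot>\<^sub>v x"
    using P Q by (auto simp: eigenvalue_def eigenvector_def)
  let ?y = "Q *\<^sub>v x"
  have y: "?y \<in> carrier_vec m" using Q x by auto
  have Py: "P *\<^sub>v ?y = k \<cdot>\<^sub>v x" using x P Q by simp
  have "?y \<noteq> 0\<^sub>v m"
  proof
    assume "?y = 0\<^sub>v m"
    moreover have "P *\<^sub>v 0\<^sub>v m = 0\<^sub>v n" using P by (intro eq_vecI) auto
    ultimately have 0: "k \<cdot>\<^sub>v x = 0\<^sub>v n" using Py by simp
    have "x $ i = 0" if "i < n" for i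
    proof -
      have "(k \<cdot>\<^sub>v x) $ i = 0" using that 0 by simp
      then show ?thesis using that k x by simp
    qed
    then show False using x by auto
  qed
  moreover have "(Q * P) *\<^sub>v ?y = k \<cdot>\<^sub>v ?y"
  proof -
    have "(Q * P) *\<^sub>v ?y = Q *\<^sub>v (P *\<^sub>v ?y)" using P Q y by simp
    then show ?thesis using Py x Q by (simp add: mult_mat_vec)
  qed
  ultimately show ?thesis using y P Q by (auto simp: eigenvalue_def eigenvector_def)
qed

text \<open>The two products may differ in size, hence in the eigenvalue 0, but 0 cannot raise the
  maximal modulus. Positive dimensions make both spectra nonempty.\<close>

lemma spectral_radius_mult_commute:
  fixes P Q :: "complex mat"
  assumes P: "P \<in> carrier_mat n m" and Q: "Q \<in> carrier_mat m n" and n: "n > 0" and m: "m > 0"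
  shows "spectral_radius (P * Q) = spectral_radius (Q * P)"
proof -
  have le: "spectral_radius (P * Q) \<le> spectral_radius (Q * P)"
    if P: "P \<in> carrier_mat n m" and Q: "Q \<in> carrier_mat m n" and n: "n > 0" and m: "m > 0"
    for P Q :: "complex mat" and n m
  proof -
    have c: "P * Q \<in> carrier_mat n n" "Q * P \<in> carrier_mat m m" using P Q by auto
    from spectral_radius_mem_max(1)[OF c(1)] n obtain k
      where k: "eigenvalue (P * Q) k" "spectral_radius (P * Q) = norm k"
      by (auto simp: spectrum_def)
    show ?thesis
    proof (cases "k = 0")
      case True
      from spectral_radius_mem_max(1)[OF c(2)] m have "0 \<le> spectral_radius (Q * P)" by auto
      then show ?thesis using True k by simp
    next
      case False
      then have "eigenvalue (Q * P) k" using eigenvalue_mult_commute[OF P Q] k by simp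
      then have "norm k \<le> spectral_radius (Q * P)"
        using spectral_radius_mem_max(2)[OF c(2)] m by (simp add: spectrum_def)
      then show ?thesis using k by simp
    qed
  qed
  show ?thesis using le[OF P Q n m] le[OF Q P m n] by simp
qed

subsection \<open>Resolvents and minimal solutions\<close>

text \<open>Domination by a matrix whose resolvent exists and is nonnegative is inherited: the row sums
  of that resolvent form the positive test vector.\<close>

lemma nonneg_resolvent_dominated:
  assumes W: "W \<in> carrier_mat n n" "nonneg_mat W" and W': "W' \<in> carrier_mat n n" "nonneg_mat W'"
    and le: "mat_le W W'"
    and Y': "Y' \<in> carrier_mat n n" "nonneg_mat Y'" "(1\<^sub>m n - W') * Y' = 1\<^sub>m n"
  obtains Y where "Y \<in> carrier_mat n n" "nonneg_mat Y" "(1\<^sub>m n - W) * Y = 1\<^sub>m n"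
    "Y * (1\<^sub>m n - W) = 1\<^sub>m n" "mat_le Y Y'"
proof -
  have "1\<^sub>m n + W' * Y' = (1\<^sub>m n - W') * Y' + W' * Y'" using Y' by simp
  also have "\<dots> = Y'"
    by (rule eq_matI) (use W' Y'(1) in \<open>auto simp: mat_expand simp del: index_mult_mat(1)\<close>)
  finally have Y'eq: "Y' = 1\<^sub>m n + W' * Y'" by simp
  have nWY: "nonneg_mat (W' * Y')" using W' Y' by (intro nonneg_mat_mult) auto
  \<comment> \<open>This vector satisfies \<open>(I - W') v = 1\<close>, and
    \<open>Y' = I + W' Y'\<close> bounds its entries below by 1. Replacing \<open>W'\<close> by the
    smaller \<open>W\<close> can only increase the left side.\<close>
  define v where "v = row_sum Y'"
  have v: "0 < v i" if i: "i < n" for i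
  proof -
    have "v i = 1 + row_sum (W' * Y') i"
      unfolding v_def using W' Y'(1) i by (subst Y'eq) (simp add: row_sum_add row_sum_one)
    moreover have "0 \<le> row_sum (W' * Y') i"
      unfolding row_sum_def using nWY W' Y' i by (intro sum_nonneg) (auto simp: nonneg_mat_def simp del: index_mult_mat(1))
    ultimately show ?thesis by simp
  qed
  have Av: "0 < (\<Sum>j<n. (1\<^sub>m n - W) $$ (i,j) * v j)" if i: "i < n" for i
  proof -
    have "1 = row_sum ((1\<^sub>m n - W') * Y') i" using Y' i by (simp add: row_sum_one)
    also have "\<dots> = (\<Sum>j<n. (1\<^sub>m n - W') $$ (i,j) * v j)"
      unfolding v_def using W' Y' i by (intro row_sum_mult[where c = n]) auto
    also have "\<dots> \<le> (\<Sum>j<n. (1\<^sub>m n - W) $$ (i,j) * v j)"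
    proof (intro sum_mono mult_right_mono)
      fix j assume j: "j \<in> {..<n}"
      show "0 \<le> v j" using v[of j] j by simp
      show "(1\<^sub>m n - W') $$ (i,j) \<le> (1\<^sub>m n - W) $$ (i,j)"
        using le i j W W' by (auto simp: mat_le_def)
    qed
    finally show ?thesis by simp
  qed
  obtain Y where Y: "Y \<in> carrier_mat n n" "(1\<^sub>m n - W) * Y = 1\<^sub>m n" "Y * (1\<^sub>m n - W) = 1\<^sub>m n" "nonneg_mat Y"
  proof (rule Z_matrix_nonneg_inverse[of "1\<^sub>m n - W" n v])
    fix i j assume "i < n" "j < n" "i \<noteq> j"
    then show "(1\<^sub>m n - W) $$ (i,j) \<le> 0" using W by (auto simp: nonneg_mat_def)
  qed (use W v Av in auto)
  \<comment> \<open>The second resolvent identity; every factor of the product on the left is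
    nonnegative.\<close>
  have "Y * (W' - W) * Y' = (Y * (1\<^sub>m n - W)) * Y' - Y * ((1\<^sub>m n - W') * Y')"
    by (rule eq_matI) (use W W' Y(1) Y'(1) in \<open>auto simp: mat_expand simp del: index_mult_mat(1)\<close>)
  also have "\<dots> = Y' - Y" using Y Y' by simp
  finally have "Y' - Y = Y * (W' - W) * Y'" by simp
  moreover have "nonneg_mat (Y * (W' - W) * Y')"
    using W W' Y Y' le by (intro nonneg_mat_mult) (auto simp: mat_le_iff_nonneg)
  ultimately have "mat_le Y Y'" using Y Y' by (simp add: mat_le_iff_nonneg)
  then show thesis using that Y by blast
qed

text \<open>The iterates from zero increase and stay below \<open>X\<close>; by continuity their
  limit \<open>L\<close> is a fixed point, so minimality forces \<open>L = X\<close>. Bounds and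
  zero patterns that hold for all iterates can thus be transferred to \<open>X\<close>.\<close>

lemma min_nonneg_sol_limit:
  fixes \<Phi> :: "real mat \<Rightarrow> real mat"
  assumes min: "min_nonneg_sol r c (\<lambda>X. \<Phi> X = X) X"
    and closed: "\<And>Y. Y \<in> carrier_mat r c \<Longrightarrow> nonneg_mat Y \<Longrightarrow> \<Phi> Y \<in> carrier_mat r c \<and> nonneg_mat (\<Phi> Y)"
    and mono: "\<And>Y Z. Y \<in> carrier_mat r c \<Longrightarrow> nonneg_mat Y \<Longrightarrow> Z \<in> carrier_mat r c \<Longrightarrow> mat_le Y Z \<Longrightarrow>
        mat_le (\<Phi> Y) (\<Phi> Z)"
    and cont: "\<And>S L i j. (\<And>k. S k \<in> carrier_mat r c) \<Longrightarrow> L \<in> carrier_mat r c \<Longrightarrow>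
        (\<And>i j. i < r \<Longrightarrow> j < c \<Longrightarrow> (\<lambda>k. S k $$ (i,j)) \<longlonglongrightarrow> L $$ (i,j)) \<Longrightarrow> i < r \<Longrightarrow> j < c \<Longrightarrow>
        (\<lambda>k. \<Phi> (S k) $$ (i,j)) \<longlonglongrightarrow> \<Phi> L $$ (i,j)"
    and i: "i < r" and j: "j < c"
  shows "(\<lambda>k. (\<Phi> ^^ k) (0\<^sub>m r c) $$ (i,j)) \<longlonglongrightarrow> X $$ (i,j)"
proof -
  define S where "S k = (\<Phi> ^^ k) (0\<^sub>m r c)" for k
  from min have X: "X \<in> carrier_mat r c" "nonneg_mat X" "\<Phi> X = X"
    and least: "\<And>Y. Y \<in> carrier_mat r c \<Longrightarrow> nonneg_mat Y \<Longrightarrow> \<Phi> Y = Y \<Longrightarrow> mat_le X Y"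
    by (auto simp: min_nonneg_sol_def)
  have S0: "S 0 = 0\<^sub>m r c" and SSuc: "S (Suc k) = \<Phi> (S k)" for k by (auto simp: S_def)
  have S: "S k \<in> carrier_mat r c" "nonneg_mat (S k)" for k
    by (induction k) (use closed in \<open>auto simp: S0 SSuc nonneg_mat_zero\<close>)
  have step: "mat_le (S k) (S (Suc k))" for k
  proof (induction k)
    case 0
    show ?case using S[of 1] by (auto simp: S0 mat_le_def nonneg_mat_def)
  next
    case (Suc k)
    then show ?case using mono[OF S(1,2)[of k] S(1)[of "Suc k"]] by (simp only: SSuc)
  qed
  have below: "mat_le (S k) X" for k
  proof (induction k)
    case 0
    show ?case using X by (auto simp: S0 mat_le_def nonneg_mat_def)
  next
    case (Suc k)
    then show ?case using mono[OF S(1,2)[of k] X(1)] X by (simp add: SSuc)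
  qed
  define L where "L = mat r c (\<lambda>(i,j). lim (\<lambda>k. S k $$ (i,j)))"
  have L: "L \<in> carrier_mat r c" by (simp add: L_def)
  have lim: "(\<lambda>k. S k $$ (i,j)) \<longlonglongrightarrow> L $$ (i,j)" if "i < r" "j < c" for i j
  proof -
    have "S k $$ (i,j) \<le> S (Suc k) $$ (i,j)" for k
      using step[of k] S(1)[of k] that by (auto simp: mat_le_def)
    then have "incseq (\<lambda>k. S k $$ (i,j))" by (rule incseq_SucI)
    moreover have "S k $$ (i,j) \<le> X $$ (i,j)" for k
      using below[of k] S(1)[of k] that by (auto simp: mat_le_def)
    ultimately have "convergent (\<lambda>k. S k $$ (i,j))"
      by (meson incseq_convergent convergentI)
    then show ?thesis using that by (simp add: L_def convergent_LIMSEQ_iff)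
  qed
  have nL: "nonneg_mat L"
    unfolding nonneg_mat_def
  proof (intro allI impI)
    fix i j assume "i < dim_row L" "j < dim_col L"
    then have ij: "i < r" "j < c" using L by auto
    have "0 \<le> S k $$ (i,j)" for k using S[of k] ij by (auto simp: nonneg_mat_def)
    then show "0 \<le> L $$ (i,j)" by (intro LIMSEQ_le_const[OF lim[OF ij]]) auto
  qed
  have "\<Phi> L = L"
  proof (rule eq_matI)
    fix i j assume "i < dim_row L" "j < dim_col L"
    then have ij: "i < r" "j < c" using L by auto
    have "(\<lambda>k. S (Suc k) $$ (i,j)) \<longlonglongrightarrow> \<Phi> L $$ (i,j)"
      unfolding SSuc by (rule cont) (use S L lim ij in auto)
    moreover have "(\<lambda>k. S (Suc k) $$ (i,j)) \<longlonglongrightarrow> L $$ (i,j)"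
      by (rule LIMSEQ_Suc[OF lim[OF ij]])
    ultimately show "\<Phi> L $$ (i,j) = L $$ (i,j)" by (rule LIMSEQ_unique)
  qed (use closed[OF L nL] L in auto)
  from least[OF L nL this] have "X $$ (i,j) \<le> L $$ (i,j)" using i j X by (auto simp: mat_le_def)
  moreover have "S k $$ (i,j) \<le> X $$ (i,j)" for k
    using below[of k] S(1)[of k] i j by (auto simp: mat_le_def)
  then have "L $$ (i,j) \<le> X $$ (i,j)" by (intro LIMSEQ_le_const2[OF lim[OF i j]]) auto
  ultimately show ?thesis using lim[OF i j] by (simp add: S_def)
qed

subsection \<open>The Riccati equation of the fluid queue\<close>

locale fluid_queue =
  fixes np nm :: nat and T Tpp Tpm Tmp Tmm \<Psi> E G H F :: "real mat" and lam mu :: real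
  assumes gen: "generator_mat (np + nm) T"
    and Tblocks: "split_block T np np = (Tpp, Tpm, Tmp, Tmm)"
    and Psi: "min_nonneg_sol np nm
               (\<lambda>X. Tpm + X * Tmm + Tpp * X + X * Tmp * X = 0\<^sub>m np nm) \<Psi>"
    and lam: "lam > 0" "\<forall>i < np + nm. \<bar>T $$ (i,i)\<bar> \<le> lam"
    and mu: "mu > 0" "\<forall>i < np + nm. \<bar>T $$ (i,i)\<bar> \<le> mu"
    and EGHF: "split_block
       (minv (four_block_mat (1\<^sub>m np - (1 / mu) \<cdot>\<^sub>m Tpp) (- ((1 / lam) \<cdot>\<^sub>m Tpm))
                             (- ((1 / mu) \<cdot>\<^sub>m Tmp)) (1\<^sub>m nm - (1 / lam) \<cdot>\<^sub>m Tmm))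
        * four_block_mat (1\<^sub>m np + (1 / lam) \<cdot>\<^sub>m Tpp) ((1 / mu) \<cdot>\<^sub>m Tpm)
                         ((1 / lam) \<cdot>\<^sub>m Tmp) (1\<^sub>m nm + (1 / mu) \<cdot>\<^sub>m Tmm)) np np = (E, G, H, F)"
begin

section \<open>The matrices defining \<open>E\<close>, \<open>G\<close>, \<open>H\<close>,
  \<open>F\<close>\<close>

definition den :: "real mat" where
  "den = four_block_mat (1\<^sub>m np - (1 / mu) \<cdot>\<^sub>m Tpp) (- ((1 / lam) \<cdot>\<^sub>m Tpm))
                        (- ((1 / mu) \<cdot>\<^sub>m Tmp)) (1\<^sub>m nm - (1 / lam) \<cdot>\<^sub>m Tmm)"

text \<open>While \<open>den\<close> is \<open>I - T D\<close> with
  \<open>D = diag (1/mu, 1/lam)\<close>, this is \<open>I + T D'\<close> with the two rates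
  exchanged in \<open>D'\<close>.\<close>

definition num :: "real mat" where
  "num = four_block_mat (1\<^sub>m np + (1 / lam) \<cdot>\<^sub>m Tpp) ((1 / mu) \<cdot>\<^sub>m Tpm)
                        ((1 / lam) \<cdot>\<^sub>m Tmp) (1\<^sub>m nm + (1 / mu) \<cdot>\<^sub>m Tmm)"

lemma T_carrier: "T \<in> carrier_mat (np + nm) (np + nm)"
  using gen by (simp add: generator_mat_def)

lemma T_blocks:
  shows Tpp_carrier: "Tpp \<in> carrier_mat np np" and Tpm_carrier: "Tpm \<in> carrier_mat np nm"
    and Tmp_carrier: "Tmp \<in> carrier_mat nm np" and Tmm_carrier: "Tmm \<in> carrier_mat nm nm"
    and T_eq: "T = four_block_mat Tpp Tpm Tmp Tmm"
  using split_block[OF Tblocks, of nm nm] T_carrier by auto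

lemma T_dims [simp]:
  "dim_row Tpp = np" "dim_col Tpp = np" "dim_row Tpm = np" "dim_col Tpm = nm"
  "dim_row Tmp = nm" "dim_col Tmp = np" "dim_row Tmm = nm" "dim_col Tmm = nm"
  using T_blocks by auto

lemma T_index:
  "i < np \<Longrightarrow> j < np \<Longrightarrow> Tpp $$ (i,j) = T $$ (i,j)"
  "i < np \<Longrightarrow> j < nm \<Longrightarrow> Tpm $$ (i,j) = T $$ (i,np + j)"
  "i < nm \<Longrightarrow> j < np \<Longrightarrow> Tmp $$ (i,j) = T $$ (np + i,j)"
  "i < nm \<Longrightarrow> j < nm \<Longrightarrow> Tmm $$ (i,j) = T $$ (np + i,np + j)"
  by (simp_all add: T_eq)

lemma T_nonneg: "i < np + nm \<Longrightarrow> j < np + nm \<Longrightarrow> i \<noteq> j \<Longrightarrow> 0 \<le> T $$ (i,j)"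
  using gen by (simp add: generator_mat_def)

lemma T_diag: "i < np + nm \<Longrightarrow> - lam \<le> T $$ (i,i)" "i < np + nm \<Longrightarrow> - mu \<le> T $$ (i,i)"
  using lam(2) mu(2) by (force simp: abs_le_iff)+

lemma T_row_sum: "i < np + nm \<Longrightarrow> row_sum T i = 0"
  using gen by (auto simp: generator_mat_def row_sum_def)

lemma T_row_sum_blocks:
  "i < np \<Longrightarrow> row_sum Tpp i + row_sum Tpm i = 0"
  "i < nm \<Longrightarrow> row_sum Tmp i + row_sum Tmm i = 0"
  using T_row_sum[of i] T_row_sum[of "np + i"] T_blocks
    row_sum_four_block[OF Tpp_carrier Tpm_carrier Tmp_carrier Tmm_carrier, of i] by auto

lemma den_carrier: "den \<in> carrier_mat (np + nm) (np + nm)"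
  and num_carrier: "num \<in> carrier_mat (np + nm) (np + nm)"
  by (auto simp: den_def num_def)

lemma den_index:
  assumes "k < np + nm" "l < np + nm"
  shows "den $$ (k,l) = (if k = l then 1 else 0) - (if l < np then 1 / mu else 1 / lam) * T $$ (k,l)"
  using assms by (auto simp: den_def T_eq)

lemma num_index:
  assumes "k < np + nm" "l < np + nm"
  shows "num $$ (k,l) = (if k = l then 1 else 0) + (if l < np then 1 / lam else 1 / mu) * T $$ (k,l)"
  using assms by (auto simp: num_def T_eq)

lemma num_nonneg: "nonneg_mat num"
  unfolding nonneg_mat_def
proof (intro allI impI)
  fix k l assume "k < dim_row num" "l < dim_col num"
  then have kl: "k < np + nm" "l < np + nm" using num_carrier by auto
  show "0 \<le> num $$ (k,l)"
  proof (cases "k = l")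
    case True
    have "0 \<le> 1 + T $$ (l,l) / lam" "0 \<le> 1 + T $$ (l,l) / mu"
      using T_diag[OF kl(2)] lam(1) mu(1) by (simp_all add: field_simps)
    then show ?thesis using kl True by (simp add: num_index)
  next
    case False
    then show ?thesis using kl T_nonneg lam(1) mu(1) by (simp add: num_index)
  qed
qed

lemma den_off_diag: "i < np + nm \<Longrightarrow> j < np + nm \<Longrightarrow> i \<noteq> j \<Longrightarrow> den $$ (i,j) \<le> 0"
  using T_nonneg lam(1) mu(1) by (simp add: den_index)

lemma minv_den:
  "minv den \<in> carrier_mat (np + nm) (np + nm)" "den * minv den = 1\<^sub>m (np + nm)"
  "minv den * den = 1\<^sub>m (np + nm)" "nonneg_mat (minv den)"
proof -
  \<comment> \<open>These weights cancel the column scaling of \<open>T\<close> inside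
    \<open>den\<close>, so \<open>den v = v - T 1 = v\<close>, which is positive.\<close>
  define v where "v l = (if l < np then mu else lam)" for l
  obtain B where B: "B \<in> carrier_mat (np + nm) (np + nm)" "den * B = 1\<^sub>m (np + nm)"
    "B * den = 1\<^sub>m (np + nm)" "nonneg_mat B"
  proof (rule Z_matrix_nonneg_inverse[OF den_carrier den_off_diag, of v])
    fix i assume i: "i < np + nm"
    show "0 < v i" using lam(1) mu(1) by (simp add: v_def)
    have "(\<Sum>j<np + nm. den $$ (i,j) * v j) = (\<Sum>j<np + nm. (if i = j then v j else 0) - T $$ (i,j))"
      using i lam(1) mu(1) by (intro sum.cong) (auto simp: den_index v_def algebra_simps)
    also have "\<dots> = v i - row_sum T i"
      using i T_carrier by (simp add: sum_subtractf row_sum_def)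
    finally show "0 < (\<Sum>j<np + nm. den $$ (i,j) * v j)" using T_row_sum[OF i] \<open>0 < v i\<close> by simp
  qed auto
  moreover have "minv den = B" using B den_carrier by (intro minv_eqI)
  ultimately show "minv den \<in> carrier_mat (np + nm) (np + nm)" "den * minv den = 1\<^sub>m (np + nm)"
    "minv den * den = 1\<^sub>m (np + nm)" "nonneg_mat (minv den)" by simp_all
qed

lemma EGHF_blocks:
  shows E_carrier: "E \<in> carrier_mat np np" and G_carrier: "G \<in> carrier_mat np nm"
    and H_carrier: "H \<in> carrier_mat nm np" and F_carrier: "F \<in> carrier_mat nm nm"
    and EGHF_eq: "four_block_mat E G H F = minv den * num"
  using split_block[OF EGHF[folded den_def num_def], of nm nm] minv_den(1) num_carrier by auto

lemmas EGHF_carriers = E_carrier G_carrier H_carrier F_carrier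

lemma EGHF_dims [simp]:
  "dim_row E = np" "dim_col E = np" "dim_row G = np" "dim_col G = nm"
  "dim_row H = nm" "dim_col H = np" "dim_row F = nm" "dim_col F = nm"
  using EGHF_blocks by auto

lemma den_EGHF: "den * four_block_mat E G H F = num"
proof -
  have "den * (minv den * num) = (den * minv den) * num"
    using den_carrier num_carrier minv_den(1) by (simp add: mult_assoc_dim)
  then show ?thesis using minv_den(2) num_carrier by (simp add: EGHF_eq)
qed

lemma EGHF_nonneg: "nonneg_mat E" "nonneg_mat G" "nonneg_mat H" "nonneg_mat F"
proof -
  have "nonneg_mat (minv den * num)"
    using minv_den num_nonneg num_carrier by (intro nonneg_mat_mult) auto
  then show "nonneg_mat E" "nonneg_mat G" "nonneg_mat H" "nonneg_mat F"
    using nonneg_mat_four_block[OF E_carrier G_carrier H_carrier F_carrier] by (auto simp: EGHF_eq)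
qed

text \<open>\<open>num - den\<close> is a multiple of \<open>T\<close>, so \<open>num\<close> and
  \<open>den\<close> agree on the all-ones vector and \<open>minv den * num\<close> fixes it.
  \<open>H\<close> and \<open>F\<close> form the lower rows of that matrix.\<close>

lemma row_sum_HF:
  assumes i: "i < nm"
  shows "row_sum H i + row_sum F i = 1"
proof -
  have eq: "row_sum num k = row_sum den k" if k: "k < np + nm" for k
  proof -
    have "row_sum num k - row_sum den k = (\<Sum>l<np + nm. num $$ (k,l) - den $$ (k,l))"
      using num_carrier den_carrier by (simp add: row_sum_def sum_subtractf)
    also have "\<dots> = (\<Sum>l<np + nm. (1 / lam + 1 / mu) * T $$ (k,l))"
      using k by (intro sum.cong) (auto simp: num_index den_index algebra_simps)
    also have "\<dots> = (1 / lam + 1 / mu) * row_sum T k"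
      using T_carrier by (simp add: row_sum_def sum_distrib_left)
    finally show ?thesis using T_row_sum[OF k] by simp
  qed
  have "row_sum H i + row_sum F i = row_sum (four_block_mat E G H F) (np + i)"
    using row_sum_four_block(2)[OF E_carrier G_carrier H_carrier F_carrier i] by simp
  also have "\<dots> = (\<Sum>k<np + nm. minv den $$ (np + i,k) * row_sum num k)"
    unfolding EGHF_eq by (rule row_sum_mult[OF minv_den(1) num_carrier]) (use i in simp)
  also have "\<dots> = (\<Sum>k<np + nm. minv den $$ (np + i,k) * row_sum den k)"
    using eq by (intro sum.cong) auto
  also have "\<dots> = row_sum (minv den * den) (np + i)"
    by (rule row_sum_mult[OF minv_den(1) den_carrier, symmetric]) (use i in simp)
  finally show ?thesis using i by (simp add: minv_den row_sum_one)
qed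

section \<open>Fixed point iteration for \<open>\<Psi>\<close>\<close>

definition ric :: "real mat \<Rightarrow> real mat" where
  "ric X = Tpm + X * Tmm + Tpp * X + X * Tmp * X"

text \<open>Uniformisation at rate \<open>lam\<close> puts the Riccati equation in fixed point form with nonnegative
  coefficients.\<close>

definition phi :: "real mat \<Rightarrow> real mat" where
  "phi X = (1 / (2 * lam)) \<cdot>\<^sub>m
    (Tpm + X * (lam \<cdot>\<^sub>m 1\<^sub>m nm + Tmm) + (lam \<cdot>\<^sub>m 1\<^sub>m np + Tpp) * X + X * (Tmp * X))"

lemma Psi_carrier: "\<Psi> \<in> carrier_mat np nm" and Psi_nonneg: "nonneg_mat \<Psi>"
  and ric_Psi: "ric \<Psi> = 0\<^sub>m np nm"
  and Psi_least: "Y \<in> carrier_mat np nm \<Longrightarrow> nonneg_mat Y \<Longrightarrow> ric Y = 0\<^sub>m np nm \<Longrightarrow> mat_le \<Psi> Y"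
  using Psi by (auto simp: min_nonneg_sol_def ric_def)

lemma Psi_dims [simp]: "dim_row \<Psi> = np" "dim_col \<Psi> = nm"
  using Psi_carrier by auto

text \<open>The added multiples of the identity make
  \<open>phi X = X + ric X / (2 * lam)\<close>.\<close>

lemma phi_fixpoint_iff:
  assumes X: "X \<in> carrier_mat np nm"
  shows "phi X = X \<longleftrightarrow> ric X = 0\<^sub>m np nm"
proof -
  have dims: "dim_row X = np" "dim_col X = nm" using X by auto
  have e: "phi X $$ (i,j) = X $$ (i,j) + ric X $$ (i,j) / (2 * lam)" if "i < np" "j < nm" for i j
    using that dims lam(1) by (simp add: phi_def ric_def mat_expand field_simps del: index_mult_mat(1))
  have d: "phi X \<in> carrier_mat np nm" "ric X \<in> carrier_mat np nm"
    using X by (auto simp: phi_def ric_def)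
  show ?thesis
  proof
    assume eq: "phi X = X"
    show "ric X = 0\<^sub>m np nm"
    proof (rule eq_matI)
      fix i j assume "i < dim_row (0\<^sub>m np nm)" "j < dim_col (0\<^sub>m np nm)"
      then show "ric X $$ (i,j) = 0\<^sub>m np nm $$ (i,j)" using e[of i j] eq lam(1) by simp
    qed (use d in auto)
  next
    assume eq: "ric X = 0\<^sub>m np nm"
    show "phi X = X"
      by (rule eq_matI) (use d X e eq in auto)
  qed
qed

lemma coeff_nonneg:
  "i < np \<Longrightarrow> j < nm \<Longrightarrow> 0 \<le> Tpm $$ (i,j)"
  "i < nm \<Longrightarrow> j < np \<Longrightarrow> 0 \<le> Tmp $$ (i,j)"
  "i < nm \<Longrightarrow> j < nm \<Longrightarrow> 0 \<le> (lam \<cdot>\<^sub>m 1\<^sub>m nm + Tmm) $$ (i,j)"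
  "i < np \<Longrightarrow> j < np \<Longrightarrow> 0 \<le> (lam \<cdot>\<^sub>m 1\<^sub>m np + Tpp) $$ (i,j)"
  using T_diag(1)[of i] T_diag(1)[of "np + i"] by (auto simp: T_index T_nonneg)

text \<open>Written as a polynomial in the entries of \<open>X\<close> with nonnegative
  coefficients, \<open>phi\<close> is seen termwise to be nonnegative, monotone and
  continuous.\<close>

lemma phi_index:
  assumes X: "X \<in> carrier_mat np nm" and ij: "i < np" "j < nm"
  shows "phi X $$ (i,j) = 1 / (2 * lam) *
    (Tpm $$ (i,j) + (\<Sum>k<nm. X $$ (i,k) * (lam \<cdot>\<^sub>m 1\<^sub>m nm + Tmm) $$ (k,j))
     + (\<Sum>k<np. (lam \<cdot>\<^sub>m 1\<^sub>m np + Tpp) $$ (i,k) * X $$ (k,j))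
     + (\<Sum>k<nm. X $$ (i,k) * (\<Sum>l<np. Tmp $$ (k,l) * X $$ (l,j))))"
proof -
  have "(X * (lam \<cdot>\<^sub>m 1\<^sub>m nm + Tmm)) $$ (i,j) = (\<Sum>k<nm. X $$ (i,k) * (lam \<cdot>\<^sub>m 1\<^sub>m nm + Tmm) $$ (k,j))"
    by (rule index_mult_sum[OF X _ ij]) auto
  moreover have "((lam \<cdot>\<^sub>m 1\<^sub>m np + Tpp) * X) $$ (i,j) = (\<Sum>k<np. (lam \<cdot>\<^sub>m 1\<^sub>m np + Tpp) $$ (i,k) * X $$ (k,j))"
    by (rule index_mult_sum[OF _ X ij]) auto
  moreover have "(X * (Tmp * X)) $$ (i,j) = (\<Sum>k<nm. X $$ (i,k) * (\<Sum>l<np. Tmp $$ (k,l) * X $$ (l,j)))"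
    using index_mult_sum[OF X mult_carrier_mat[OF Tmp_carrier X] ij] index_mult_sum[OF Tmp_carrier X _ ij(2)]
    by simp
  moreover have "phi X $$ (i,j) = 1 / (2 * lam) * (Tpm $$ (i,j) + (X * (lam \<cdot>\<^sub>m 1\<^sub>m nm + Tmm)) $$ (i,j)
      + ((lam \<cdot>\<^sub>m 1\<^sub>m np + Tpp) * X) $$ (i,j) + (X * (Tmp * X)) $$ (i,j))"
    unfolding phi_def using X ij by (simp del: index_mult_mat(1))
  ultimately show ?thesis by presburger
qed

lemma phi_carrier: "X \<in> carrier_mat np nm \<Longrightarrow> phi X \<in> carrier_mat np nm"
  by (auto simp: phi_def)

lemma phi_nonneg:
  assumes X: "X \<in> carrier_mat np nm" "nonneg_mat X"
  shows "nonneg_mat (phi X)"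
proof -
  have X0: "0 \<le> X $$ (i,j)" if "i < np" "j < nm" for i j
    using X that by (auto simp: nonneg_mat_def)
  have "0 \<le> phi X $$ (i,j)" if ij: "i < np" "j < nm" for i j
    unfolding phi_index[OF X(1) ij] using lam(1) ij X0 coeff_nonneg
    by (intro mult_nonneg_nonneg add_nonneg_nonneg sum_nonneg) auto
  then show ?thesis using phi_carrier[OF X(1)] by (auto simp: nonneg_mat_def)
qed

lemma phi_mono:
  assumes X: "X \<in> carrier_mat np nm" "nonneg_mat X" and Y: "Y \<in> carrier_mat np nm" and le: "mat_le X Y"
  shows "mat_le (phi X) (phi Y)"
proof -
  have leI: "X $$ (i,j) \<le> Y $$ (i,j)" and X0: "0 \<le> X $$ (i,j)" and Y0: "0 \<le> Y $$ (i,j)"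
    if "i < np" "j < nm" for i j
    using le X that by (force simp: mat_le_def nonneg_mat_def)+
  have "phi X $$ (i,j) \<le> phi Y $$ (i,j)" if ij: "i < np" "j < nm" for i j
    unfolding phi_index[OF X(1) ij] phi_index[OF Y ij]
    using lam(1) ij leI X0 Y0 coeff_nonneg
    by (intro mult_left_mono add_mono sum_mono mult_mono sum_nonneg mult_nonneg_nonneg) auto
  then show ?thesis using phi_carrier[OF X(1)] by (auto simp: mat_le_def)
qed

lemma Psi_limit:
  assumes "i < np" "j < nm"
  shows "(\<lambda>k. (phi ^^ k) (0\<^sub>m np nm) $$ (i,j)) \<longlonglongrightarrow> \<Psi> $$ (i,j)"
proof (rule min_nonneg_sol_limit[OF _ _ _ _ assms])
  show "min_nonneg_sol np nm (\<lambda>X. phi X = X) \<Psi>"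
    using Psi_carrier Psi_nonneg ric_Psi Psi_least phi_fixpoint_iff
    by (auto simp: min_nonneg_sol_def)
next
  fix S :: "nat \<Rightarrow> real mat" and L i j
  assume S: "\<And>k. S k \<in> carrier_mat np nm" and L: "L \<in> carrier_mat np nm"
    and lim: "\<And>i j. i < np \<Longrightarrow> j < nm \<Longrightarrow> (\<lambda>k. S k $$ (i,j)) \<longlonglongrightarrow> L $$ (i,j)"
    and ij: "i < np" "j < nm"
  show "(\<lambda>k. phi (S k) $$ (i,j)) \<longlonglongrightarrow> phi L $$ (i,j)"
    unfolding phi_index[OF S ij] phi_index[OF L ij]
    by (intro tendsto_intros lim) (use ij in auto)
qed (use phi_carrier phi_nonneg phi_mono in auto)

lemma iterate_carrier: "(phi ^^ k) (0\<^sub>m np nm) \<in> carrier_mat np nm"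
  by (induction k) (auto intro: phi_carrier)

lemma iterate_nonneg: "nonneg_mat ((phi ^^ k) (0\<^sub>m np nm))"
  by (induction k) (auto intro: phi_nonneg iterate_carrier simp: nonneg_mat_zero)

section \<open>Substochasticity and zero rows of \<open>\<Psi>\<close>\<close>

text \<open>Bounding the inner row sums of \<open>X\<close> by 1 leaves row sums of
  \<open>T\<close>, which cancel; what remains is the average of 1 and the row sum of
  \<open>X\<close>.\<close>

lemma phi_row_sum:
  assumes X: "X \<in> carrier_mat np nm" "nonneg_mat X" and le: "\<And>i. i < np \<Longrightarrow> row_sum X i \<le> 1"
    and i: "i < np"
  shows "row_sum (phi X) i \<le> 1"
proof -
  have dims: "dim_row X = np" "dim_col X = nm" using X by auto
  have X0: "0 \<le> X $$ (i,k)" if "k < nm" for k using X i that by (auto simp: nonneg_mat_def)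
  have "row_sum (phi X) i = 1 / (2 * lam) * (row_sum Tpm i
      + row_sum (X * (lam \<cdot>\<^sub>m 1\<^sub>m nm + Tmm)) i + row_sum ((lam \<cdot>\<^sub>m 1\<^sub>m np + Tpp) * X) i
      + row_sum (X * (Tmp * X)) i)"
    unfolding phi_def using i dims by (simp add: row_sum_smult row_sum_add)
  also have "\<dots> \<le> 1 / (2 * lam) * (row_sum Tpm i + (\<Sum>k<nm. X $$ (i,k) * (lam + row_sum Tmm k))
      + (lam + row_sum Tpp i) + (\<Sum>k<nm. X $$ (i,k) * row_sum Tmp k))"
  proof -
    have "row_sum (X * (lam \<cdot>\<^sub>m 1\<^sub>m nm + Tmm)) i = (\<Sum>k<nm. X $$ (i,k) * row_sum (lam \<cdot>\<^sub>m 1\<^sub>m nm + Tmm) k)"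
      by (rule row_sum_mult[OF X(1) _ i, of _ nm]) auto
    also have "\<dots> = (\<Sum>k<nm. X $$ (i,k) * (lam + row_sum Tmm k))"
      by (intro sum.cong) (auto simp: row_sum_add row_sum_smult row_sum_one)
    finally have 1: "row_sum (X * (lam \<cdot>\<^sub>m 1\<^sub>m nm + Tmm)) i = (\<Sum>k<nm. X $$ (i,k) * (lam + row_sum Tmm k))" .
    have "row_sum ((lam \<cdot>\<^sub>m 1\<^sub>m np + Tpp) * X) i = (\<Sum>k<np. (lam \<cdot>\<^sub>m 1\<^sub>m np + Tpp) $$ (i,k) * row_sum X k)"
      by (rule row_sum_mult[OF _ X(1) i]) auto
    also have "\<dots> \<le> (\<Sum>k<np. (lam \<cdot>\<^sub>m 1\<^sub>m np + Tpp) $$ (i,k) * 1)"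
      using le coeff_nonneg(4) i by (intro sum_mono mult_left_mono) auto
    also have "\<dots> = row_sum (lam \<cdot>\<^sub>m 1\<^sub>m np + Tpp) i" by (simp add: row_sum_def)
    also have "\<dots> = lam + row_sum Tpp i" using i by (simp add: row_sum_add row_sum_smult row_sum_one)
    finally have 2: "row_sum ((lam \<cdot>\<^sub>m 1\<^sub>m np + Tpp) * X) i \<le> lam + row_sum Tpp i" .
    have TX: "row_sum (Tmp * X) k \<le> row_sum Tmp k" if k: "k < nm" for k
    proof -
      have "row_sum (Tmp * X) k = (\<Sum>l<np. Tmp $$ (k,l) * row_sum X l)"
        by (rule row_sum_mult[OF Tmp_carrier X(1) k])
      also have "\<dots> \<le> (\<Sum>l<np. Tmp $$ (k,l) * 1)"
        using le coeff_nonneg(2) k by (intro sum_mono mult_left_mono) auto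
      finally show ?thesis by (simp add: row_sum_def)
    qed
    have "row_sum (X * (Tmp * X)) i = (\<Sum>k<nm. X $$ (i,k) * row_sum (Tmp * X) k)"
      by (rule row_sum_mult[OF X(1) _ i, of _ nm]) (use X in auto)
    also have "\<dots> \<le> (\<Sum>k<nm. X $$ (i,k) * row_sum Tmp k)"
      using TX X0 by (intro sum_mono mult_left_mono) auto
    finally have 3: "row_sum (X * (Tmp * X)) i \<le> (\<Sum>k<nm. X $$ (i,k) * row_sum Tmp k)" .
    show ?thesis using 1 2 3 lam(1) by (intro mult_left_mono) auto
  qed
  also have "\<dots> = 1 / (2 * lam) * (row_sum Tpp i + row_sum Tpm i + lam
      + (\<Sum>k<nm. X $$ (i,k) * (lam + (row_sum Tmp k + row_sum Tmm k))))"
    by (simp add: sum.distrib algebra_simps)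
  also have "\<dots> = 1 / (2 * lam) * (lam + lam * row_sum X i)"
    using T_row_sum_blocks(1)[OF i] T_row_sum_blocks(2) dims by (simp add: row_sum_def[of X] sum_distrib_left mult.commute)
  also have "\<dots> \<le> 1 / (2 * lam) * (lam + lam * 1)"
    using le[OF i] lam(1) by (intro mult_left_mono add_left_mono) auto
  finally show ?thesis using lam(1) by simp
qed

lemma Psi_row_sum:
  assumes i: "i < np"
  shows "row_sum \<Psi> i \<le> 1"
proof -
  have *: "row_sum ((phi ^^ k) (0\<^sub>m np nm)) i \<le> 1" if "i < np" for k i
    using that
  proof (induction k arbitrary: i)
    case 0
    then show ?case by (simp add: row_sum_def)
  next
    case (Suc k)
    then show ?case using phi_row_sum[OF iterate_carrier iterate_nonneg, of k] by simp
  qed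
  have "(\<lambda>k. row_sum ((phi ^^ k) (0\<^sub>m np nm)) i) \<longlonglongrightarrow> row_sum \<Psi> i"
    unfolding row_sum_def carrier_matD(2)[OF iterate_carrier] using i
    by (auto intro!: tendsto_sum Psi_limit)
  then show ?thesis using *[OF i] by (intro LIMSEQ_le_const2) auto
qed

text \<open>From \<open>A\<close> no transition leads to \<open>S_-\<close> or to the rest of
  \<open>S_+\<close>, so a first return from \<open>A\<close> has probability 0. Formally, every
  iterate of \<open>phi\<close> from zero keeps the rows in \<open>A\<close> equal to zero.\<close>

lemma Psi_zero_on_closed:
  assumes A: "\<And>k j. k \<in> A \<Longrightarrow> j < nm \<Longrightarrow> Tpm $$ (k,j) = 0"
    and closed: "\<And>k l. k \<in> A \<Longrightarrow> l < np \<Longrightarrow> k \<noteq> l \<Longrightarrow> Tpp $$ (k,l) \<noteq> 0 \<Longrightarrow> l \<in> A"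
    and sub: "A \<subseteq> {..<np}" and i: "i \<in> A" and j: "j < nm"
  shows "\<Psi> $$ (i,j) = 0"
proof -
  have "(phi ^^ m) (0\<^sub>m np nm) $$ (i,j) = 0" if "i \<in> A" "j < nm" for m i j
    using that
  proof (induction m arbitrary: i j)
    case 0
    then show ?case using sub by auto
  next
    case (Suc m)
    let ?X = "(phi ^^ m) (0\<^sub>m np nm)"
    have i: "i < np" using Suc.prems sub by auto
    have "(lam \<cdot>\<^sub>m 1\<^sub>m np + Tpp) $$ (i,k) * ?X $$ (k,j) = 0" if k: "k < np" for k
    proof (cases "k \<in> A")
      case True
      then show ?thesis using Suc by simp
    next
      case False
      then have "Tpp $$ (i,k) = 0" "i \<noteq> k" using closed[of i k] Suc.prems k by auto
      then show ?thesis using i k by simp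
    qed
    then have "(\<Sum>k<np. (lam \<cdot>\<^sub>m 1\<^sub>m np + Tpp) $$ (i,k) * ?X $$ (k,j)) = 0"
      by (intro sum.neutral) auto
    then have "phi ?X $$ (i,j) = 0"
      unfolding phi_index[OF iterate_carrier i Suc.prems(2)]
      using Suc A by (simp del: index_add_mat index_smult_mat)
    then show ?case by simp
  qed
  from this[OF i j] show ?thesis
    using Psi_limit[of i j] i j sub LIMSEQ_unique[OF _ tendsto_const, of 0 "\<Psi> $$ (i,j)"] by auto
qed

text \<open>A row of \<open>F\<close> vanishes only if the states entered from it never leave \<open>S\<^sub>+\<close>; those have
  vanishing rows in \<open>\<Psi>\<close>.\<close>

lemma H_Psi_row_sum:
  assumes i: "i < nm"
  shows "row_sum (H * \<Psi>) i < 1"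
proof (cases "\<forall>j<nm. F $$ (i,j) = 0")
  case F0: True
  let ?B = "minv den" and ?i = "np + i"
  have i': "?i < np + nm" using i by simp
  have B0: "0 \<le> ?B $$ (?i,k)" if "k < np + nm" for k
    using minv_den(1,4) that i by (auto simp: nonneg_mat_def)
  have S: "four_block_mat E G H F $$ (?i,l) = (\<Sum>k<np + nm. ?B $$ (?i,k) * num $$ (k,l))"
    if "l < np + nm" for l
    unfolding EGHF_eq by (rule index_mult_sum[OF minv_den(1) num_carrier i' that])
  have num0: "0 \<le> num $$ (k,l)" if "k < np + nm" "l < np + nm" for k l
    using num_nonneg num_carrier that by (auto simp: nonneg_mat_def)
  \<comment> \<open>Positivity spreads along transitions into \<open>S_+\<close>: the entry of
    \<open>?B * den = I\<close> at \<open>(?i,l)\<close> is 0, yet if \<open>?B\<close> vanished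
    there, every term of the sum would be nonpositive and the term for \<open>k\<close>
    negative.\<close>
  have reach: "0 < ?B $$ (?i,l)"
    if k: "k < np + nm" "0 < ?B $$ (?i,k)" and l: "l < np" and kl: "k \<noteq> l" "0 < T $$ (k,l)" for k l
  proof (rule ccontr)
    assume "\<not> ?thesis"
    then have Bl: "?B $$ (?i,l) = 0" using B0[of l] l by simp
    have term_le: "?B $$ (?i,m) * den $$ (m,l) \<le> 0" if "m < np + nm" for m
      using that Bl B0[OF that] den_off_diag[of m l] l
      by (cases "m = l") (auto simp: mult_nonneg_nonpos)
    have "den $$ (k,l) < 0" using k l kl mu(1) by (simp add: den_index)
    then have "?B $$ (?i,k) * den $$ (k,l) < 0" using k by (simp add: mult_pos_neg)
    then have "(\<Sum>m<np + nm. ?B $$ (?i,m) * den $$ (m,l)) < (\<Sum>m<np + nm. 0)"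
      using k term_le by (intro sum_strict_mono_ex1) auto
    moreover have "(\<Sum>m<np + nm. ?B $$ (?i,m) * den $$ (m,l)) = 0"
      using index_mult_sum[OF minv_den(1) den_carrier i', of l] l i by (simp add: minv_den(3))
    ultimately show False by simp
  qed
  \<comment> \<open>The states of \<open>S_+\<close> with positive weight in this row of the
    inverse. The zero row of \<open>F\<close> excludes transitions from \<open>A\<close> to
    \<open>S_-\<close>, and \<open>reach\<close> keeps \<open>A\<close> closed within
    \<open>S_+\<close>.\<close>
  define A where "A = {k. k < np \<and> 0 < ?B $$ (?i,k)}"
  have Tpm0: "Tpm $$ (k,j) = 0" if k: "k \<in> A" and j: "j < nm" for k j
  proof -
    have "(\<Sum>k<np + nm. ?B $$ (?i,k) * num $$ (k,np + j)) = 0"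
      using S[of "np + j"] F0 i j by simp
    moreover have "0 \<le> ?B $$ (?i,k) * num $$ (k,np + j)" if "k < np + nm" for k
      using that j B0 num0 by simp
    ultimately have "\<forall>k\<in>{..<np + nm}. ?B $$ (?i,k) * num $$ (k,np + j) = 0"
      by (subst (asm) sum_nonneg_eq_0_iff) auto
    moreover have "k \<in> {..<np + nm}" using k by (simp add: A_def)
    ultimately have "?B $$ (?i,k) * num $$ (k,np + j) = 0" by blast
    then have "num $$ (k,np + j) = 0" using k by (auto simp: A_def)
    then show ?thesis using k j mu(1) by (simp add: num_index A_def T_index)
  qed
  have closed: "l \<in> A" if k: "k \<in> A" and l: "l < np" "k \<noteq> l" and n0: "Tpp $$ (k,l) \<noteq> 0" for k l
  proof -
    have "0 < T $$ (k,l)" using k l n0 T_nonneg[of k l] by (auto simp: A_def T_index less_le)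
    then show ?thesis using reach[of k l] k l by (auto simp: A_def)
  qed
  \<comment> \<open>A nonzero \<open>H $$ (i,k)\<close> requires a state of positive weight that is
    \<open>k\<close> itself or has a transition to \<open>k\<close>; hence \<open>k\<close> lies in
    \<open>A\<close>, where \<open>\<Psi>\<close> has zero rows.\<close>
  have "H $$ (i,k) * \<Psi> $$ (k,j) = 0" if k: "k < np" and j: "j < nm" for k j
  proof (cases "H $$ (i,k) = 0")
    case False
    then have "(\<Sum>l<np + nm. ?B $$ (?i,l) * num $$ (l,k)) \<noteq> 0" using S[of k] k i by simp
    then obtain l where l: "l < np + nm" "?B $$ (?i,l) \<noteq> 0" "num $$ (l,k) \<noteq> 0"
      by (metis (no_types, lifting) lessThan_iff mult_eq_0_iff sum.neutral)
    have Bl: "0 < ?B $$ (?i,l)" using B0[OF l(1)] l(2) by simp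
    have "k \<in> A"
    proof (cases "l = k")
      case True
      then show ?thesis using Bl k by (simp add: A_def)
    next
      case False
      then have "0 < T $$ (l,k)" using l k T_nonneg[of l k] lam(1) by (auto simp: num_index less_le)
      then show ?thesis using reach[OF l(1) Bl k False] k by (simp add: A_def)
    qed
    then have "\<Psi> $$ (k,j) = 0"
      using Tpm0 closed j by (intro Psi_zero_on_closed[of A]) (auto simp: A_def)
    then show ?thesis by simp
  qed simp
  then have "(H * \<Psi>) $$ (i,j) = 0" if "j < nm" for j
    unfolding index_mult_sum[OF H_carrier Psi_carrier i that] using that by (intro sum.neutral) auto
  then have "row_sum (H * \<Psi>) i = 0" by (simp add: row_sum_def del: index_mult_mat(1))
  then show ?thesis by simp
next
  case False
  \<comment> \<open>Row \<open>i\<close> of \<open>F\<close> now carries positive mass. Rows of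
    \<open>H\<close> and \<open>F\<close> share the total mass 1, and multiplying \<open>H\<close>
    by the substochastic \<open>\<Psi>\<close> cannot increase its share.\<close>
  then obtain j where j: "j < nm" "F $$ (i,j) \<noteq> 0" by auto
  have F0: "0 \<le> F $$ (i,j)" if "j < nm" for j using EGHF_nonneg(4) i that by (auto simp: nonneg_mat_def)
  have "0 < row_sum F i"
    unfolding row_sum_def using j F0 by (intro sum_pos2[of _ j]) (auto simp: less_le)
  moreover have "row_sum (H * \<Psi>) i \<le> row_sum H i"
  proof -
    have "row_sum (H * \<Psi>) i = (\<Sum>k<np. H $$ (i,k) * row_sum \<Psi> k)"
      by (rule row_sum_mult[OF H_carrier Psi_carrier i])
    also have "\<dots> \<le> (\<Sum>k<np. H $$ (i,k) * 1)"
      using Psi_row_sum EGHF_nonneg(3) i by (intro sum_mono mult_left_mono) (auto simp: nonneg_mat_def)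
    finally show ?thesis by (simp add: row_sum_def)
  qed
  ultimately show ?thesis using row_sum_HF[OF i] by simp
qed

section \<open>Inverses involving \<open>\<Psi>\<close>\<close>

lemma inverse_one_minus_H_Psi:
  obtains J where "J \<in> carrier_mat nm nm" "(1\<^sub>m nm - H * \<Psi>) * J = 1\<^sub>m nm"
    "J * (1\<^sub>m nm - H * \<Psi>) = 1\<^sub>m nm" "nonneg_mat J"
proof (rule Z_matrix_nonneg_inverse[of "1\<^sub>m nm - H * \<Psi>" nm "\<lambda>_. 1"])
  fix i j assume ij: "i < nm" "j < nm" "i \<noteq> j"
  have "nonneg_mat (H * \<Psi>)" using EGHF_nonneg(3) Psi_nonneg by (intro nonneg_mat_mult) auto
  then show "(1\<^sub>m nm - H * \<Psi>) $$ (i,j) \<le> 0"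
    using ij by (auto simp: nonneg_mat_def simp del: index_mult_mat(1))
next
  fix i assume i: "i < nm"
  have "(\<Sum>j<nm. (1\<^sub>m nm - H * \<Psi>) $$ (i,j) * 1) = row_sum (1\<^sub>m nm - H * \<Psi>) i"
    by (simp add: row_sum_def)
  also have "\<dots> = 1 - row_sum (H * \<Psi>) i" using i by (simp add: row_sum_minus row_sum_one)
  finally show "0 < (\<Sum>j<nm. (1\<^sub>m nm - H * \<Psi>) $$ (i,j) * 1)" using H_Psi_row_sum[OF i] by simp
qed auto

text \<open>\<open>Tmm + Tmp * \<Psi>\<close> generates the phase process at successive record
  minima of the level: its off-diagonal entries are nonnegative and its row sums at most 0. The
  all-ones vector therefore serves as test vector.\<close>

lemma inverse_return_generator:
  obtains L where "L \<in> carrier_mat nm nm" "(1\<^sub>m nm - (1 / lam) \<cdot>\<^sub>m (Tmm + Tmp * \<Psi>)) * L = 1\<^sub>m nm"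
proof (rule Z_matrix_nonneg_inverse[of "1\<^sub>m nm - (1 / lam) \<cdot>\<^sub>m (Tmm + Tmp * \<Psi>)" nm "\<lambda>_. 1"])
  fix i j assume ij: "i < nm" "j < nm" "i \<noteq> j"
  have "nonneg_mat (Tmp * \<Psi>)"
    using coeff_nonneg(2) Psi_nonneg by (intro nonneg_mat_mult) (auto simp: nonneg_mat_def)
  then have "0 \<le> (Tmp * \<Psi>) $$ (i,j)" using ij by (auto simp: nonneg_mat_def simp del: index_mult_mat(1))
  moreover have "0 \<le> Tmm $$ (i,j)" using ij by (simp add: T_index T_nonneg)
  ultimately show "(1\<^sub>m nm - (1 / lam) \<cdot>\<^sub>m (Tmm + Tmp * \<Psi>)) $$ (i,j) \<le> 0"
    using ij lam(1) by (simp del: index_mult_mat(1))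
next
  fix i assume i: "i < nm"
  have "row_sum (Tmp * \<Psi>) i = (\<Sum>k<np. Tmp $$ (i,k) * row_sum \<Psi> k)"
    by (rule row_sum_mult[OF Tmp_carrier Psi_carrier i])
  also have "\<dots> \<le> (\<Sum>k<np. Tmp $$ (i,k) * 1)"
    using Psi_row_sum coeff_nonneg(2) i by (intro sum_mono mult_left_mono) auto
  finally have "row_sum (Tmp * \<Psi>) i \<le> row_sum Tmp i" by (simp add: row_sum_def)
  then have le: "row_sum Tmm i + row_sum (Tmp * \<Psi>) i \<le> 0" using T_row_sum_blocks(2)[OF i] by simp
  have "(\<Sum>j<nm. (1\<^sub>m nm - (1 / lam) \<cdot>\<^sub>m (Tmm + Tmp * \<Psi>)) $$ (i,j) * 1)
      = row_sum (1\<^sub>m nm - (1 / lam) \<cdot>\<^sub>m (Tmm + Tmp * \<Psi>)) i" by (simp add: row_sum_def)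
  also have "\<dots> = 1 - (1 / lam) * (row_sum Tmm i + row_sum (Tmp * \<Psi>) i)"
    using i by (simp add: row_sum_minus row_sum_one row_sum_smult row_sum_add)
  also have "\<dots> > 0"
    using le lam(1) by (simp add: field_simps)
  finally show "0 < (\<Sum>j<nm. (1\<^sub>m nm - (1 / lam) \<cdot>\<^sub>m (Tmm + Tmp * \<Psi>)) $$ (i,j) * 1)" .
qed auto

subsection \<open>The Cayley transform\<close>

text \<open>Both equations together say \<open>S V = P\<close> for block matrices with zero first
  column, where \<open>S\<close> holds \<open>E\<close>, \<open>G\<close>, \<open>H\<close>,
  \<open>F\<close>. Multiplying by the invertible \<open>den\<close> replaces \<open>S\<close> by
  \<open>num\<close> and leaves equations in the blocks of \<open>T\<close> alone.\<close>

lemma cayley_fixpoint_iff: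
  assumes X: "X \<in> carrier_mat np nm" and Z: "Z \<in> carrier_mat nm nm"
  shows "E * X * Z + G = X \<and> H * X * Z + F = Z \<longleftrightarrow>
    (1\<^sub>m np - (1 / mu) \<cdot>\<^sub>m Tpp) * X + (- ((1 / lam) \<cdot>\<^sub>m Tpm)) * Z
      = (1\<^sub>m np + (1 / lam) \<cdot>\<^sub>m Tpp) * (X * Z) + (1 / mu) \<cdot>\<^sub>m Tpm * 1\<^sub>m nm \<and>
    (- ((1 / mu) \<cdot>\<^sub>m Tmp)) * X + (1\<^sub>m nm - (1 / lam) \<cdot>\<^sub>m Tmm) * Z
      = (1 / lam) \<cdot>\<^sub>m Tmp * (X * Z) + (1\<^sub>m nm + (1 / mu) \<cdot>\<^sub>m Tmm) * 1\<^sub>m nm"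
    (is "?fix \<longleftrightarrow> ?e1 = ?f1 \<and> ?e2 = ?f2")
proof -
  let ?P = "four_block_mat (0\<^sub>m np np) X (0\<^sub>m nm np) Z"
  let ?V = "four_block_mat (0\<^sub>m np np) (X * Z) (0\<^sub>m nm np) (1\<^sub>m nm)"
  let ?S = "four_block_mat E G H F"
  have dims: "dim_row X = np" "dim_col X = nm" "dim_row Z = nm" "dim_col Z = nm" using X Z by auto
  have PV: "?P \<in> carrier_mat (np + nm) (np + nm)" "?V \<in> carrier_mat (np + nm) (np + nm)"
    using X Z by auto
  have Sc: "?S \<in> carrier_mat (np + nm) (np + nm)" using EGHF_carriers by simp
  have SV: "?S * ?V = four_block_mat (0\<^sub>m np np) (E * X * Z + G) (0\<^sub>m nm np) (H * X * Z + F)"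
    by (subst mult_four_block_mat[of _ np np _ nm _ nm _ _ np _ nm])
      (use X Z EGHF_carriers dims in \<open>auto simp: mat_expand\<close>)
  have numV: "num * ?V = den * (?S * ?V)"
  proof -
    have "num * ?V = (den * ?S) * ?V" by (simp only: den_EGHF)
    then show ?thesis using den_carrier Sc PV by (simp add: mult_assoc_dim)
  qed
  have denP: "den * ?P = four_block_mat (0\<^sub>m np np) ?e1 (0\<^sub>m nm np) ?e2"
    unfolding den_def
    by (subst mult_four_block_mat[of _ np np _ nm _ nm _ _ np _ nm])
      (use X Z dims in \<open>auto simp: add_zero_dim\<close>)
  have numV': "num * ?V = four_block_mat (0\<^sub>m np np) ?f1 (0\<^sub>m nm np) ?f2"
    unfolding num_def
    by (subst mult_four_block_mat[of _ np np _ nm _ nm _ _ np _ nm])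
      (use X Z dims in \<open>auto simp: add_zero_dim\<close>)
  have "?fix \<longleftrightarrow> ?S * ?V = ?P"
  proof
    assume ?fix
    then show "?S * ?V = ?P" by (simp only: SV)
  next
    assume "?S * ?V = ?P"
    from four_block_mat_eqD(2,4)[OF this[unfolded SV], of np np nm nm]
    show ?fix using X Z EGHF_carriers by auto
  qed
  also have "\<dots> \<longleftrightarrow> den * ?P = den * (?S * ?V)"
  proof
    assume eq: "den * ?P = den * (?S * ?V)"
    have "?P = (minv den * den) * ?P" using PV(1) by (simp only: minv_den left_mult_one_mat)
    also have "\<dots> = minv den * (den * (?S * ?V))"
      using minv_den(1) den_carrier PV by (simp add: mult_assoc_dim flip: eq)
    also have "\<dots> = (minv den * den) * (?S * ?V)"
      using minv_den(1) den_carrier PV Sc by (simp add: mult_assoc_dim)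
    also have "\<dots> = ?S * ?V" using mult_carrier_mat[OF Sc PV(2)] by (simp only: minv_den left_mult_one_mat)
    finally show "?S * ?V = ?P" by simp
  qed simp
  also have "\<dots> \<longleftrightarrow> four_block_mat (0\<^sub>m np np) ?e1 (0\<^sub>m nm np) ?e2
      = four_block_mat (0\<^sub>m np np) ?f1 (0\<^sub>m nm np) ?f2"
    using numV numV' denP by metis
  also have "\<dots> \<longleftrightarrow> ?e1 = ?f1 \<and> ?e2 = ?f2"
  proof
    assume eq: "four_block_mat (0\<^sub>m np np) ?e1 (0\<^sub>m nm np) ?e2
      = four_block_mat (0\<^sub>m np np) ?f1 (0\<^sub>m nm np) ?f2"
    have c: "?e1 \<in> carrier_mat np nm" "?e2 \<in> carrier_mat nm nm" "?f1 \<in> carrier_mat np nm"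
      "?f2 \<in> carrier_mat nm nm" using dims by auto
    show "?e1 = ?f1 \<and> ?e2 = ?f2"
      using four_block_mat_eqD(2,4)[OF eq zero_carrier_mat c(1) zero_carrier_mat c(2)
          zero_carrier_mat c(3) zero_carrier_mat c(4)] by simp
  qed simp
  finally show ?thesis .
qed

text \<open>With \<open>Q = mu\<inverse> I + lam\<inverse> Z\<close> the second equation says \<open>Z = I + (T\<^sub>-\<^sub>- + T\<^sub>-\<^sub>+ X) Q\<close>, which makes
  \<open>Q\<close> invertible, and then the first one becomes \<open>ric X * Q = 0\<close>.\<close>

lemma cayley_fixpoint_iff_ric:
  assumes X: "X \<in> carrier_mat np nm" and Z: "Z \<in> carrier_mat nm nm"
  shows "E * X * Z + G = X \<and> H * X * Z + F = Z \<longleftrightarrow>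
    Z = 1\<^sub>m nm + (Tmm + Tmp * X) * ((1 / mu) \<cdot>\<^sub>m 1\<^sub>m nm + (1 / lam) \<cdot>\<^sub>m Z) \<and> ric X = 0\<^sub>m np nm"
proof -
  define U where "U = Tmm + Tmp * X"
  define Q where "Q = (1 / mu) \<cdot>\<^sub>m 1\<^sub>m nm + (1 / lam) \<cdot>\<^sub>m Z"
  have dims: "dim_row X = np" "dim_col X = nm" "dim_row Z = nm" "dim_col Z = nm" using X Z by auto
  have U: "U \<in> carrier_mat nm nm" and Q: "Q \<in> carrier_mat nm nm" and ric: "ric X \<in> carrier_mat np nm"
    using dims by (auto simp: ric_def U_def Q_def)
  let ?e1 = "(1\<^sub>m np - (1 / mu) \<cdot>\<^sub>m Tpp) * X + (- ((1 / lam) \<cdot>\<^sub>m Tpm)) * Z"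
  let ?f1 = "(1\<^sub>m np + (1 / lam) \<cdot>\<^sub>m Tpp) * (X * Z) + (1 / mu) \<cdot>\<^sub>m Tpm * 1\<^sub>m nm"
  let ?e2 = "(- ((1 / mu) \<cdot>\<^sub>m Tmp)) * X + (1\<^sub>m nm - (1 / lam) \<cdot>\<^sub>m Tmm) * Z"
  let ?f2 = "(1 / lam) \<cdot>\<^sub>m Tmp * (X * Z) + (1\<^sub>m nm + (1 / mu) \<cdot>\<^sub>m Tmm) * 1\<^sub>m nm"
  have "?e2 - ?f2 = Z - (1\<^sub>m nm + U * Q)"
    unfolding U_def Q_def
    by (rule eq_matI) (use dims in \<open>auto simp: mat_expand algebra_simps simp del: index_mult_mat(1)\<close>)
  then have 2: "?e2 = ?f2 \<longleftrightarrow> Z = 1\<^sub>m nm + U * Q"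
    by (subst (1 2) mat_eq_iff_minus[where r = nm and c = nm]) (use dims U Q in auto)
  have 1: "?e1 = ?f1 \<longleftrightarrow> ric X = 0\<^sub>m np nm" if ZQ: "Z = 1\<^sub>m nm + U * Q"
  proof -
    have e: "?e1 - ?f1 = X - X * Z - (Tpp * X + Tpm) * Q"
      unfolding Q_def
      by (rule eq_matI) (use dims in \<open>auto simp: mat_expand algebra_simps simp del: index_mult_mat(1)\<close>)
    have XZ: "X * Z = X + X * U * Q"
    proof -
      have "X * Z = X * (1\<^sub>m nm + U * Q)" by (rule arg_cong[OF ZQ])
      also have "\<dots> = X + X * U * Q" using X U Q by (simp add: mult_add_dim mult_assoc_dim)
      finally show ?thesis .
    qed
    have r: "ric X = X * U + (Tpp * X + Tpm)"
      by (rule eq_matI) (use dims in \<open>auto simp: ric_def U_def mat_expand simp del: index_mult_mat(1)\<close>)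
    have "?e1 - ?f1 = - (ric X * Q)"
    proof -
      have "ric X * Q = X * U * Q + (Tpp * X + Tpm) * Q"
        unfolding r using X U Q by (intro add_mult_dim) auto
      then show ?thesis
        unfolding e unfolding XZ using X U Q by (intro eq_matI) (auto simp del: index_mult_mat(1))
    qed
    moreover have "?e1 = ?f1 \<longleftrightarrow> ?e1 - ?f1 = 0\<^sub>m np nm"
      by (rule mat_eq_iff_minus) (use dims in auto)
    ultimately have "?e1 = ?f1 \<longleftrightarrow> ric X * Q = 0\<^sub>m np nm"
      by (metis uminus_uminus_mat uminus_zero_dim)
    also have "\<dots> \<longleftrightarrow> ric X = 0\<^sub>m np nm"
    proof
      assume 0: "ric X * Q = 0\<^sub>m np nm"
      \<comment> \<open>Normalising constant: substituting \<open>U Q = Z - I\<close> gives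
        \<open>(I - U / lam) Q = (1/mu + 1/lam) I\<close>, so \<open>L\<close> below inverts
        \<open>Q\<close>.\<close>
      define s where "s = 1 / (1 / mu + 1 / lam)"
      define L where "L = s \<cdot>\<^sub>m (1\<^sub>m nm - (1 / lam) \<cdot>\<^sub>m U)"
      have Lc: "L \<in> carrier_mat nm nm" using U by (auto simp: L_def)
      have pos: "1 / mu + 1 / lam \<noteq> 0" using lam(1) mu(1) by (simp add: add_pos_pos less_imp_neq[symmetric])
      have UQ: "(U * Q) $$ (i,j) = Z $$ (i,j) - 1\<^sub>m nm $$ (i,j)" if "i < nm" "j < nm" for i j
      proof -
        have "Z $$ (i,j) = (1\<^sub>m nm + U * Q) $$ (i,j)" by (rule arg_cong[OF ZQ])
        also have "\<dots> = 1\<^sub>m nm $$ (i,j) + (U * Q) $$ (i,j)" using that U Q by (intro index_add_mat) auto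
        finally show ?thesis by simp
      qed
      have "L * Q = s \<cdot>\<^sub>m (Q - (1 / lam) \<cdot>\<^sub>m (U * Q))"
        unfolding L_def using U Q by (simp add: smult_mult_dim minus_mult_dim)
      also have "\<dots> = 1\<^sub>m nm"
      proof (rule eq_matI)
        fix i j assume "i < dim_row (1\<^sub>m nm :: real mat)" "j < dim_col (1\<^sub>m nm :: real mat)"
        then have ij: "i < nm" "j < nm" by auto
        have "(s \<cdot>\<^sub>m (Q - (1 / lam) \<cdot>\<^sub>m (U * Q))) $$ (i,j) = s * (Q $$ (i,j) - 1 / lam * (U * Q) $$ (i,j))"
          using ij Q U by (simp del: index_mult_mat(1) index_add_mat)
        also have "\<dots> = s * ((1 / mu + 1 / lam) * 1\<^sub>m nm $$ (i,j))"
          unfolding UQ[OF ij] using ij dims by (simp add: Q_def algebra_simps)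
        also have "\<dots> = 1\<^sub>m nm $$ (i,j)" using pos unfolding s_def by (simp add: mult.assoc[symmetric])
        finally show "(s \<cdot>\<^sub>m (Q - (1 / lam) \<cdot>\<^sub>m (U * Q))) $$ (i,j) = 1\<^sub>m nm $$ (i,j)" .
      qed (use U Q in auto)
      finally have QL: "Q * L = 1\<^sub>m nm" by (rule mat_mult_left_right_inverse[OF Lc Q])
      have "ric X = ric X * (Q * L)" using QL ric by simp
      also have "\<dots> = ric X * Q * L" using ric Q Lc by (simp add: mult_assoc_dim)
      also have "\<dots> = 0\<^sub>m np nm" using 0 Lc by simp
      finally show "ric X = 0\<^sub>m np nm" .
    qed (use Q in \<open>simp\<close>)
    finally show ?thesis .
  qed
  show ?thesis unfolding cayley_fixpoint_iff[OF X Z] U_def[symmetric] Q_def[symmetric] using 1 2 by blast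
qed

text \<open>With \<open>U = Tmm + Tmp * \<Psi>\<close>, the equation for \<open>Z\<close> reads
  \<open>(I - U / lam) Z = I + U / mu\<close>; its left factor is invertible, so \<open>Z\<close> is
  a Cayley transform of \<open>U\<close>.\<close>

lemma Psi_cayley_fixpoint:
  obtains Z where "Z \<in> carrier_mat nm nm" "E * \<Psi> * Z + G = \<Psi>" "H * \<Psi> * Z + F = Z"
proof -
  let ?U = "Tmm + Tmp * \<Psi>"
  have U: "?U \<in> carrier_mat nm nm" by auto
  obtain L where L: "L \<in> carrier_mat nm nm" "(1\<^sub>m nm - (1 / lam) \<cdot>\<^sub>m ?U) * L = 1\<^sub>m nm"
    by (rule inverse_return_generator)
  define Z where "Z = L * (1\<^sub>m nm + (1 / mu) \<cdot>\<^sub>m ?U)"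
  have Z: "Z \<in> carrier_mat nm nm" using L U by (auto simp: Z_def)
  have "(1\<^sub>m nm - (1 / lam) \<cdot>\<^sub>m ?U) * Z = (1\<^sub>m nm - (1 / lam) \<cdot>\<^sub>m ?U) * L * (1\<^sub>m nm + (1 / mu) \<cdot>\<^sub>m ?U)"
    unfolding Z_def using L(1) U by (subst mult_assoc_dim) auto
  also have "\<dots> = 1\<^sub>m nm + (1 / mu) \<cdot>\<^sub>m ?U" using L U by simp
  finally have eq: "Z - (1 / lam) \<cdot>\<^sub>m (?U * Z) = 1\<^sub>m nm + (1 / mu) \<cdot>\<^sub>m ?U"
    using U Z by (simp add: minus_mult_dim smult_mult_dim)
  have "Z = 1\<^sub>m nm + ?U * ((1 / mu) \<cdot>\<^sub>m 1\<^sub>m nm + (1 / lam) \<cdot>\<^sub>m Z)" (is "_ = ?r")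
  proof (rule eq_matI)
    fix i j assume "i < dim_row ?r" "j < dim_col ?r"
    then have ij: "i < nm" "j < nm" using Z by auto
    have "(Z - (1 / lam) \<cdot>\<^sub>m (?U * Z)) $$ (i,j) = (1\<^sub>m nm + (1 / mu) \<cdot>\<^sub>m ?U) $$ (i,j)" using eq by simp
    moreover have "?U * ((1 / mu) \<cdot>\<^sub>m 1\<^sub>m nm + (1 / lam) \<cdot>\<^sub>m Z) = (1 / mu) \<cdot>\<^sub>m ?U + (1 / lam) \<cdot>\<^sub>m (?U * Z)"
      using U Z by (simp add: mult_add_dim mult_smult_dim)
    ultimately show "Z $$ (i,j) = ?r $$ (i,j)"
      using ij U Z by (simp add: algebra_simps del: index_mult_mat(1))
  qed (use Z in auto)
  then show thesis
    using cayley_fixpoint_iff_ric[OF Psi_carrier Z] ric_Psi that Z by blast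
qed

subsection \<open>The rate matrix of the QBD\<close>

abbreviation dim where "dim \<equiv> np + nm"

text \<open>\<open>K\<close> stands for \<open>I - C0\<close>. With \<open>up\<close> and
  \<open>down\<close> below, \<open>K * up\<close> is \<open>C1\<close> and \<open>K * down\<close>
  is \<open>Cm1\<close>, so these two are the transition blocks after left multiplication by the
  inverse of \<open>I - C0\<close>.\<close>

definition K :: "real mat" where "K = (1 / 2) \<cdot>\<^sub>m den"

definition up :: "real mat" where "up = four_block_mat E (0\<^sub>m np nm) H (0\<^sub>m nm nm)"

definition down :: "real mat" where "down = four_block_mat (0\<^sub>m np np) G (0\<^sub>m nm np) F"

lemma K_carrier: "K \<in> carrier_mat dim dim"
  and up_carrier: "up \<in> carrier_mat dim dim"
  and down_carrier: "down \<in> carrier_mat dim dim"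
  using den_carrier by (auto simp: K_def up_def down_def)

lemma minv_K: "minv K = 2 \<cdot>\<^sub>m minv den"
  by (rule minv_eqI[OF K_carrier])
    (use den_carrier minv_den in \<open>auto simp: K_def smult_mult_dim mult_smult_dim smult_smult_dim\<close>)

lemma inverse_K:
  "minv K \<in> carrier_mat dim dim" "K * minv K = 1\<^sub>m dim" "minv K * K = 1\<^sub>m dim" "nonneg_mat (minv K)"
  using den_carrier minv_den unfolding minv_K
  by (auto simp: K_def smult_mult_dim mult_smult_dim smult_smult_dim nonneg_mat_smult)

lemma one_minus_K_nonneg: "nonneg_mat (1\<^sub>m dim - K)"
  unfolding nonneg_mat_def
proof (intro allI impI)
  fix k l assume "k < dim_row (1\<^sub>m dim - K)" "l < dim_col (1\<^sub>m dim - K)"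
  then have kl: "k < dim" "l < dim" using K_carrier by auto
  have e: "(1\<^sub>m dim - K) $$ (k,l)
    = ((if k = l then 1 else 0) + (if l < np then 1 / mu else 1 / lam) * T $$ (k,l)) / 2"
    using kl den_carrier by (auto simp: K_def den_index field_simps)
  show "0 \<le> (1\<^sub>m dim - K) $$ (k,l)"
  proof (cases "k = l")
    case True
    have "0 \<le> 1 + T $$ (l,l) / lam" "0 \<le> 1 + T $$ (l,l) / mu"
      using T_diag[OF kl(2)] lam(1) mu(1) by (simp_all add: field_simps)
    then show ?thesis using True unfolding e by simp
  next
    case False
    then show ?thesis using kl T_nonneg[of k l] lam(1) mu(1) unfolding e by simp
  qed
qed

text \<open>\<open>up\<close> and \<open>down\<close> arise from the block matrix of
  \<open>E\<close>, \<open>G\<close>, \<open>H\<close>, \<open>F\<close> by selecting block columns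
  on the right, which commutes with the left multiplication turning that matrix into
  \<open>num\<close>.\<close>

lemma K_up: "K * up = (1 / 2) \<cdot>\<^sub>m (num * four_block_mat (1\<^sub>m np) (0\<^sub>m np nm) (0\<^sub>m nm np) (0\<^sub>m nm nm))"
  (is "_ = _ \<cdot>\<^sub>m (_ * ?I)")
  and K_down: "K * down = (1 / 2) \<cdot>\<^sub>m (num * four_block_mat (0\<^sub>m np np) (0\<^sub>m np nm) (0\<^sub>m nm np) (1\<^sub>m nm))"
  (is "_ = _ \<cdot>\<^sub>m (_ * ?I')")
proof -
  let ?S = "four_block_mat E G H F"
  have S: "?S \<in> carrier_mat dim dim" by auto
  have I: "?I \<in> carrier_mat dim dim" "?I' \<in> carrier_mat dim dim" by auto
  have up: "up = ?S * ?I"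
    unfolding up_def by (subst mult_four_block_mat[of _ np np _ nm _ nm _ _ np _ nm])
      (use EGHF_carriers in \<open>auto simp: add_zero_dim\<close>)
  have down: "down = ?S * ?I'"
    unfolding down_def by (subst mult_four_block_mat[of _ np np _ nm _ nm _ _ np _ nm])
      (use EGHF_carriers in \<open>auto simp: add_zero_dim\<close>)
  have *: "K * (?S * M) = (1 / 2) \<cdot>\<^sub>m (num * M)" if M: "M \<in> carrier_mat dim dim" for M
  proof -
    have "K * (?S * M) = (1 / 2) \<cdot>\<^sub>m (den * (?S * M))"
      unfolding K_def by (rule smult_mult_dim) (use den_carrier in auto)
    also have "den * (?S * M) = (den * ?S) * M"
      by (rule mult_assoc_dim[symmetric]) (use den_carrier M in auto)
    finally show ?thesis by (simp only: den_EGHF)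
  qed
  show "K * up = (1 / 2) \<cdot>\<^sub>m (num * ?I)" unfolding up by (rule *[OF I(1)])
  show "K * down = (1 / 2) \<cdot>\<^sub>m (num * ?I')" unfolding down by (rule *[OF I(2)])
qed

lemma K_up_nonneg: "nonneg_mat (K * up)" and K_down_nonneg: "nonneg_mat (K * down)"
proof -
  have *: "nonneg_mat ((1 / 2) \<cdot>\<^sub>m (num * M))" if "M \<in> carrier_mat dim dim" "nonneg_mat M" for M
    using that num_nonneg num_carrier by (intro nonneg_mat_smult nonneg_mat_mult) auto
  show "nonneg_mat (K * up)" unfolding K_up by (rule *) (auto simp: nonneg_mat_def)
  show "nonneg_mat (K * down)" unfolding K_down by (rule *) (auto simp: nonneg_mat_def)
qed

lemma up_mult:
  assumes X: "X \<in> carrier_mat np nm" and Z: "Z \<in> carrier_mat nm nm"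
  shows "up * four_block_mat (0\<^sub>m np np) X (0\<^sub>m nm np) Z
    = four_block_mat (0\<^sub>m np np) (E * X) (0\<^sub>m nm np) (H * X)"
  unfolding up_def
  by (subst mult_four_block_mat[of _ np np _ nm _ nm _ _ np _ nm])
    (use EGHF_carriers X Z in \<open>auto simp: add_zero_dim\<close>)

text \<open>Reduces the matrix equation for \<open>W\<close> to the pair of equations treated in
  \<open>cayley_fixpoint_iff\<close>.\<close>

lemma up_mult_mult:
  assumes X: "X \<in> carrier_mat np nm" and Z: "Z \<in> carrier_mat nm nm"
  defines "W \<equiv> four_block_mat (0\<^sub>m np np) X (0\<^sub>m nm np) Z"
  shows "up * W * W + down = four_block_mat (0\<^sub>m np np) (E * X * Z + G) (0\<^sub>m nm np) (H * X * Z + F)"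
proof -
  have "up * W * W = four_block_mat (0\<^sub>m np np) (E * X * Z) (0\<^sub>m nm np) (H * X * Z)"
    unfolding W_def up_mult[OF X Z]
    by (subst mult_four_block_mat[of _ np np _ nm _ nm _ _ np _ nm])
      (use EGHF_carriers X Z in \<open>auto simp: add_zero_dim\<close>)
  then show ?thesis
    unfolding down_def using X Z by (intro eq_matI) (auto simp del: index_mult_mat(1))
qed

text \<open>A minimal solution \<open>R\<close> generates, through the dominated resolvent
  \<open>(I - C\<^sub>0 - R C\<^sub>-\<^sub>1)\<inverse>\<close>, a nonnegative solution of the Riccati equation, so that minimality of \<open>\<Psi>\<close>
  forces equality.\<close>

lemma minimal_R_eq:
  assumes R: "min_nonneg_sol dim dim (\<lambda>R. R * R * (K * down) + R * (1\<^sub>m dim - K) + K * up = R) R"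
    and J: "J \<in> carrier_mat nm nm" "(1\<^sub>m nm - H * \<Psi>) * J = 1\<^sub>m nm"
      "J * (1\<^sub>m nm - H * \<Psi>) = 1\<^sub>m nm" "nonneg_mat J"
  shows "R = K * up * four_block_mat (1\<^sub>m np) (E * \<Psi> * J) (0\<^sub>m nm np) J * minv K"
proof -
  \<comment> \<open>\<open>V\<close> will be the inverse of the block triangular
    \<open>D = I - up W\<close>, and \<open>Y\<close> consequently the inverse of
    \<open>K D = I - C0 - C1 W\<close>.\<close>
  define V where "V = four_block_mat (1\<^sub>m np) (E * \<Psi> * J) (0\<^sub>m nm np) J"
  define Y where "Y = V * minv K"
  define R' where "R' = K * up * Y"
  obtain Z where Z: "Z \<in> carrier_mat nm nm" "E * \<Psi> * Z + G = \<Psi>" "H * \<Psi> * Z + F = Z"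
    by (rule Psi_cayley_fixpoint)
  define W where "W = four_block_mat (0\<^sub>m np np) \<Psi> (0\<^sub>m nm np) Z"
  define D where "D = 1\<^sub>m dim - up * W"
  have Jd: "dim_row J = nm" "dim_col J = nm" using J by auto
  have V: "V \<in> carrier_mat dim dim" using J by (auto simp: V_def)
  have W: "W \<in> carrier_mat dim dim" using Z by (auto simp: W_def)
  have D: "D \<in> carrier_mat dim dim" using up_carrier W by (auto simp: D_def)
  have Y: "Y \<in> carrier_mat dim dim" using V inverse_K by (auto simp: Y_def)
  have R': "R' \<in> carrier_mat dim dim" using Y K_carrier up_carrier by (auto simp: R'_def)
  note c = K_carrier up_carrier down_carrier V W D Y R' inverse_K(1)
  have nV: "nonneg_mat V"
    unfolding V_def using EGHF_nonneg Psi_nonneg J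
    by (subst nonneg_mat_four_block[of _ np np _ nm _ nm])
      (auto intro!: nonneg_mat_mult simp: nonneg_mat_one nonneg_mat_zero)
  have nY: "nonneg_mat Y" unfolding Y_def using nV inverse_K V by (intro nonneg_mat_mult) auto
  have nR': "nonneg_mat R'" unfolding R'_def using c by (intro nonneg_mat_mult[OF K_up_nonneg nY]) auto
  have D_block: "D = four_block_mat (1\<^sub>m np) (- (E * \<Psi>)) (0\<^sub>m nm np) (1\<^sub>m nm - H * \<Psi>)"
    unfolding D_def W_def up_mult[OF Psi_carrier Z(1)]
    by (rule eq_matI) (auto simp del: index_mult_mat(1))
  have VD: "V * D = 1\<^sub>m dim"
  proof -
    have "E * \<Psi> * J * (1\<^sub>m nm - H * \<Psi>) = E * \<Psi> * (J * (1\<^sub>m nm - H * \<Psi>))"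
      by (rule mult_assoc_dim) (use Jd in auto)
    then have "- (E * \<Psi>) + E * \<Psi> * J * (1\<^sub>m nm - H * \<Psi>) = 0\<^sub>m np nm"
      using J by (intro eq_matI) (auto simp del: index_mult_mat(1))
    then have "V * D = four_block_mat (1\<^sub>m np) (0\<^sub>m np nm) (0\<^sub>m nm np) (1\<^sub>m nm)"
      unfolding V_def D_block
      by (subst mult_four_block_mat[of _ np np _ nm _ nm _ _ np _ nm])
        (use J Jd in \<open>auto simp: add_zero_dim uminus_zero_dim\<close>)
    then show ?thesis by simp
  qed
  have DV: "D * V = 1\<^sub>m dim" by (rule mat_mult_left_right_inverse[OF V D VD])
  have KDY: "(K * D) * Y = 1\<^sub>m dim"
  proof -
    have "(K * D) * Y = K * (D * V) * minv K" unfolding Y_def using c by (simp add: mult_assoc_dim)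
    then show ?thesis using c by (simp add: DV inverse_K)
  qed
  have YKD: "Y * (K * D) = 1\<^sub>m dim"
    by (rule mat_mult_left_right_inverse[OF _ Y KDY]) (use c in auto)
  \<comment> \<open>The equation for \<open>W\<close> factors as \<open>D W = down\<close>; hence
    \<open>W = Y (K down)\<close>, the form in which it is later compared with
    \<open>W1\<close>.\<close>
  have "up * W * W + down = W"
    unfolding W_def up_mult_mult[OF Psi_carrier Z(1)] by (simp only: Z(2,3))
  then have DW: "D * W = down"
  proof -
    assume eq: "up * W * W + down = W"
    have "D * W = W - up * W * W" unfolding D_def using c by (simp add: minus_mult_dim)
    also have "\<dots> = (up * W * W + down) - up * W * W" by (simp only: eq)
    also have "\<dots> = down" using c by (intro eq_matI) (auto simp del: index_mult_mat(1))
    finally show ?thesis .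
  qed
  have R'down: "R' * (K * down) = K * up * W"
  proof -
    have "R' * (K * down) = K * up * (Y * (K * D)) * W"
      unfolding R'_def DW[symmetric] using c by (simp add: mult_assoc_dim)
    then show ?thesis using c by (simp add: YKD)
  qed
  have KD: "K * D = 1\<^sub>m dim - ((1\<^sub>m dim - K) + K * up * W)"
    unfolding D_def using c
    by (intro eq_matI) (auto simp: mult_minus_dim mult_assoc_dim simp del: index_mult_mat(1))
  have R'KD: "R' * (K * D) = K * up"
  proof -
    have "R' * (K * D) = K * up * (Y * (K * D))" unfolding R'_def using c by (simp add: mult_assoc_dim)
    then show ?thesis using c by (simp add: YKD)
  qed
  \<comment> \<open>Because \<open>R' (K down) = K up W\<close>, the quadratic equation for
    \<open>R'\<close> reduces to the linear one \<open>R' (K D) = K up\<close>.\<close>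
  have R'_sol: "R' * R' * (K * down) + R' * (1\<^sub>m dim - K) + K * up = R'"
  proof -
    let ?P = "R' * (K * up * W)" and ?Q = "R' * (1\<^sub>m dim - K)"
    have P: "R' * R' * (K * down) = ?P"
      using c by (simp add: mult_assoc_dim flip: R'down)
    have "R' * (K * D) = R' - (?Q + ?P)"
      unfolding KD using c by (simp add: mult_minus_dim mult_add_dim)
    then have up: "K * up = R' - (?Q + ?P)" by (simp only: R'KD)
    have "?P + ?Q + K * up = ?P + ?Q + (R' - (?Q + ?P))" by (rule arg_cong[OF up])
    also have "\<dots> = R'" using c by (intro eq_matI) (auto simp del: index_mult_mat(1))
    finally show ?thesis by (simp only: P)
  qed
  from R have Rc: "R \<in> carrier_mat dim dim" "nonneg_mat R"
    and R_sol: "R * R * (K * down) + R * (1\<^sub>m dim - K) + K * up = R"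
    and R_le: "mat_le R R'"
    using R' nR' R'_sol by (auto simp: min_nonneg_sol_def)
  \<comment> \<open>\<open>I - B'\<close> equals \<open>K D\<close> and has the nonnegative inverse
    \<open>Y\<close>. From \<open>R \<le> R'\<close> follows \<open>B \<le> B'\<close>, so
    \<open>I - B\<close> has a nonnegative inverse \<open>Y1 \<le> Y\<close>.\<close>
  define B where "B = (1\<^sub>m dim - K) + R * (K * down)"
  define B' where "B' = (1\<^sub>m dim - K) + R' * (K * down)"
  have B: "B \<in> carrier_mat dim dim" "B' \<in> carrier_mat dim dim" using c Rc by (auto simp: B_def B'_def)
  have "nonneg_mat (R * (K * down))" "nonneg_mat (R' * (K * down))"
    using c Rc by (auto intro!: nonneg_mat_mult[OF _ K_down_nonneg] nR')
  then have nB: "nonneg_mat B" "nonneg_mat B'"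
    unfolding B_def B'_def using one_minus_K_nonneg c Rc by (auto intro!: nonneg_mat_add)
  have "B' - B = (R' - R) * (K * down)"
    unfolding B_def B'_def using c Rc
    by (intro eq_matI) (auto simp: minus_mult_dim simp del: index_mult_mat(1))
  moreover have "nonneg_mat ((R' - R) * (K * down))"
    using R_le Rc c by (intro nonneg_mat_mult[OF _ K_down_nonneg]) (auto simp: mat_le_iff_nonneg)
  ultimately have le: "mat_le B B'" using B by (simp add: mat_le_iff_nonneg)
  have KD_B': "K * D = 1\<^sub>m dim - B'" unfolding KD B'_def R'down ..
  obtain Y1 where Y1: "Y1 \<in> carrier_mat dim dim" "nonneg_mat Y1"
    "(1\<^sub>m dim - B) * Y1 = 1\<^sub>m dim" "Y1 * (1\<^sub>m dim - B) = 1\<^sub>m dim" "mat_le Y1 Y"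
    by (rule nonneg_resolvent_dominated[OF B(1) nB(1) B(2) nB(2) le Y nY KDY[unfolded KD_B']])
  have RB: "R * (1\<^sub>m dim - B) = K * up"
  proof -
    have "R * (1\<^sub>m dim - B) = R - (R * (1\<^sub>m dim - K) + R * R * (K * down))"
      unfolding B_def using c Rc by (simp add: mult_minus_dim mult_add_dim mult_assoc_dim)
    also have "\<dots> = (R * R * (K * down) + R * (1\<^sub>m dim - K) + K * up) - (R * (1\<^sub>m dim - K) + R * R * (K * down))"
      by (simp only: R_sol)
    also have "\<dots> = K * up" using c Rc by (intro eq_matI) (auto simp del: index_mult_mat(1))
    finally show ?thesis .
  qed
  define W1 where "W1 = Y1 * (K * down)"
  have W1: "W1 \<in> carrier_mat dim dim" using Y1 c by (auto simp: W1_def)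
  have nW1: "nonneg_mat W1" unfolding W1_def using Y1 c by (intro nonneg_mat_mult[OF _ K_down_nonneg]) auto
  have Rdown: "R * (K * down) = K * up * W1"
  proof -
    have "R = R * ((1\<^sub>m dim - B) * Y1)" using Y1 Rc by simp
    also have "\<dots> = (K * up) * Y1"
      unfolding RB[symmetric] by (rule mult_assoc_dim[symmetric]) (use Rc B Y1 in auto)
    finally have R_eq: "R = K * up * Y1" .
    show ?thesis unfolding W1_def using c Y1 by (subst R_eq) (simp add: mult_assoc_dim)
  qed
  have KD1: "1\<^sub>m dim - B = K * (1\<^sub>m dim - up * W1)"
    unfolding B_def Rdown using c W1
    by (intro eq_matI) (auto simp: mult_minus_dim mult_assoc_dim simp del: index_mult_mat(1))
  \<comment> \<open>\<open>(I - B) W1 = K down\<close> and \<open>I - B = K (I - up W1)\<close>;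
    cancelling \<open>K\<close> leaves the equation that \<open>W\<close> satisfies too.\<close>
  have W1_fix: "up * W1 * W1 + down = W1"
  proof -
    have "K * ((1\<^sub>m dim - up * W1) * W1) = (1\<^sub>m dim - B) * W1"
      unfolding KD1 by (rule mult_assoc_dim[symmetric]) (use c W1 in auto)
    also have "\<dots> = ((1\<^sub>m dim - B) * Y1) * (K * down)"
      unfolding W1_def by (rule mult_assoc_dim[symmetric]) (use c B Y1 in auto)
    also have "\<dots> = K * down" using Y1 c by simp
    finally have "minv K * (K * ((1\<^sub>m dim - up * W1) * W1)) = minv K * (K * down)" by simp
    then have "(minv K * K) * ((1\<^sub>m dim - up * W1) * W1) = (minv K * K) * down"
      using c W1 by (simp add: mult_assoc_dim)
    then have "(1\<^sub>m dim - up * W1) * W1 = down" using c W1 by (simp add: inverse_K)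
    then have "down = W1 - up * W1 * W1" using c W1 by (simp add: minus_mult_dim)
    then show ?thesis using c W1 by (intro eq_matI) (auto simp del: index_mult_mat(1))
  qed
  \<comment> \<open>The first block column of \<open>K * down\<close> is zero, and left
    multiplication by \<open>Y1\<close> preserves this.\<close>
  obtain X1 Z1 where X1: "X1 \<in> carrier_mat np nm" and Z1: "Z1 \<in> carrier_mat nm nm"
    and W1_block: "W1 = four_block_mat (0\<^sub>m np np) X1 (0\<^sub>m nm np) Z1"
  proof -
    obtain p q r t where s': "split_block Y1 np np = (p, q, r, t)" by (cases "split_block Y1 np np")
    note s' = split_block[OF s', of nm nm]
    obtain p' q' r' t' where u: "split_block K np np = (p', q', r', t')" by (cases "split_block K np np")
    note u = split_block[OF u, of nm nm]
    have s': "p \<in> carrier_mat np np" "q \<in> carrier_mat np nm" "r \<in> carrier_mat nm np" "t \<in> carrier_mat nm nm"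
      "Y1 = four_block_mat p q r t" using s' Y1 by auto
    have u: "p' \<in> carrier_mat np np" "q' \<in> carrier_mat np nm" "r' \<in> carrier_mat nm np" "t' \<in> carrier_mat nm nm"
      "K = four_block_mat p' q' r' t'" using u c by auto
    have Kdown: "K * down = four_block_mat (0\<^sub>m np np) (p' * G + q' * F) (0\<^sub>m nm np) (r' * G + t' * F)"
      unfolding down_def u(5)
      by (subst mult_four_block_mat[of _ np np _ nm _ nm _ _ np _ nm])
        (use u(1-4) EGHF_carriers in \<open>auto simp: add_zero_dim\<close>)
    have "W1 = four_block_mat (0\<^sub>m np np) (p * (p' * G + q' * F) + q * (r' * G + t' * F)) (0\<^sub>m nm np)
        (r * (p' * G + q' * F) + t * (r' * G + t' * F))"
      unfolding W1_def Kdown s'(5)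
      by (subst mult_four_block_mat[of _ np np _ nm _ nm _ _ np _ nm])
        (use s'(1-4) u(1-4) EGHF_carriers in \<open>auto simp: add_zero_dim\<close>)
    then show thesis using that[of "p * (p' * G + q' * F) + q * (r' * G + t' * F)"
        "r * (p' * G + q' * F) + t * (r' * G + t' * F)"] s'(1-4) u(1-4) EGHF_carriers by auto
  qed
  have blocks: "four_block_mat (0\<^sub>m np np) (E * X1 * Z1 + G) (0\<^sub>m nm np) (H * X1 * Z1 + F)
      = four_block_mat (0\<^sub>m np np) X1 (0\<^sub>m nm np) Z1"
    using W1_fix up_mult_mult[OF X1 Z1] unfolding W1_block by simp
  have "E * X1 * Z1 + G \<in> carrier_mat np nm" "H * X1 * Z1 + F \<in> carrier_mat nm nm"
    by auto
  from four_block_mat_eqD(2,4)[OF blocks zero_carrier_mat this(1) zero_carrier_mat this(2)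
      zero_carrier_mat X1 zero_carrier_mat Z1]
  have "ric X1 = 0\<^sub>m np nm" using cayley_fixpoint_iff_ric[OF X1 Z1] by blast
  moreover have "nonneg_mat X1"
    using nW1 nonneg_mat_four_block[OF zero_carrier_mat X1 zero_carrier_mat Z1] unfolding W1_block by simp
  ultimately have Psi_le: "mat_le \<Psi> X1" using Psi_least[OF X1] by blast
  have "K * up * W1 = K * up * W"
  proof -
    \<comment> \<open>\<open>Y1 \<le> Y\<close> yields \<open>W1 \<le> W\<close>, whose upper right
      block is \<open>X1 \<le> \<Psi>\<close>, the inequality opposite to the one from minimality of
      \<open>\<Psi>\<close>.\<close>
    have "W - W1 = (Y - Y1) * (K * down)"
    proof -
      have "Y * (K * down) = (Y * (K * D)) * W" unfolding DW[symmetric] using c by (simp add: mult_assoc_dim)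
      then have "Y * (K * down) = W" using c by (simp add: YKD)
      then show ?thesis unfolding W1_def using c Y1 by (simp add: minus_mult_dim)
    qed
    moreover have "nonneg_mat ((Y - Y1) * (K * down))"
      using Y1 Y c by (intro nonneg_mat_mult[OF _ K_down_nonneg]) (auto simp: mat_le_iff_nonneg)
    moreover have "W - W1 = four_block_mat (0\<^sub>m np np - 0\<^sub>m np np) (\<Psi> - X1) (0\<^sub>m nm np - 0\<^sub>m nm np) (Z - Z1)"
      unfolding W_def W1_block
      by (rule minus_four_block_mat[OF zero_carrier_mat Psi_carrier zero_carrier_mat Z(1)
            zero_carrier_mat X1 zero_carrier_mat Z1])
    ultimately have "nonneg_mat (four_block_mat (0\<^sub>m np np - 0\<^sub>m np np) (\<Psi> - X1) (0\<^sub>m nm np - 0\<^sub>m nm np) (Z - Z1))"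
      by simp
    then have "nonneg_mat (\<Psi> - X1)"
      using X1 Z1 by (subst (asm) nonneg_mat_four_block[of _ np np _ nm _ nm]) auto
    then have "mat_le X1 \<Psi>" using X1 by (simp add: mat_le_iff_nonneg)
    then have "X1 = \<Psi>" using Psi_le X1 by (intro mat_le_antisym) auto
    \<comment> \<open>Only the upper right block enters these products, so
      \<open>X1 = \<Psi>\<close> suffices.\<close>
    then have "up * W1 = up * W"
      unfolding W1_block W_def using up_mult[OF X1 Z1] up_mult[OF Psi_carrier Z(1)] by simp
    then show ?thesis using c W1 by (simp add: mult_assoc_dim)
  qed
  then have "B = B'" unfolding B_def B'_def Rdown R'down by simp
  then have RKD: "R * (K * D) = K * up" using RB by (simp only: KD_B')
  have "R = R * ((K * D) * Y)" using Rc by (simp add: KDY)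
  also have "\<dots> = (R * (K * D)) * Y" by (rule mult_assoc_dim[symmetric]) (use c Rc in auto)
  also have "\<dots> = K * up * V * minv K"
    unfolding RKD Y_def by (rule mult_assoc_dim[symmetric]) (use c in auto)
  finally show ?thesis unfolding V_def .
qed

section \<open>The matrix \<open>R1\<close> and the spectral radius\<close>

text \<open>Push-through identity: if \<open>J\<close> inverts \<open>I - H \<Psi>\<close>, then
  \<open>I + \<Psi> J H\<close> inverts \<open>I - \<Psi> H\<close>. The second conclusion rewrites
  the upper right block of the triangular factor, the third serves the spectral radius.\<close>

lemma inverse_one_minus_Psi_H:
  assumes J: "J \<in> carrier_mat nm nm" "(1\<^sub>m nm - H * \<Psi>) * J = 1\<^sub>m nm"
      "J * (1\<^sub>m nm - H * \<Psi>) = 1\<^sub>m nm"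
  defines "R1 \<equiv> E * minv (1\<^sub>m np - \<Psi> * H)"
  shows "R1 \<in> carrier_mat np np" "R1 * \<Psi> = E * \<Psi> * J" "E + R1 * \<Psi> * H = R1"
proof -
  have Jd: "dim_row J = nm" "dim_col J = nm" using J by auto
  define M where "M = 1\<^sub>m np + \<Psi> * J * H"
  have M: "M \<in> carrier_mat np np" by (auto simp: M_def)
  have "(1\<^sub>m np - \<Psi> * H) * M = 1\<^sub>m np - \<Psi> * H + \<Psi> * ((1\<^sub>m nm - H * \<Psi>) * J) * H"
    unfolding M_def by (rule eq_matI) (use Jd in \<open>auto simp: mat_expand simp del: index_mult_mat(1)\<close>)
  also have "\<dots> = 1\<^sub>m np" unfolding J(2) by (rule eq_matI) (auto simp del: index_mult_mat(1))
  finally have inv: "(1\<^sub>m np - \<Psi> * H) * M = 1\<^sub>m np" .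
  have c: "1\<^sub>m np - \<Psi> * H \<in> carrier_mat np np" by auto
  have "minv (1\<^sub>m np - \<Psi> * H) = M"
    by (rule minv_eqI[OF c M inv mat_mult_left_right_inverse[OF c M inv]])
  then have R1: "R1 = E * M" by (simp add: R1_def)
  then show "R1 \<in> carrier_mat np np" using M by auto
  have "M * \<Psi> = \<Psi> * (1\<^sub>m nm - J * (1\<^sub>m nm - H * \<Psi>) + J)"
    unfolding M_def by (rule eq_matI) (use Jd in \<open>auto simp: mat_expand simp del: index_mult_mat(1)\<close>)
  also have "\<dots> = \<Psi> * J"
    unfolding J(3) by (rule arg_cong[of _ _ "\<lambda>A. \<Psi> * A"], rule eq_matI) (use Jd in auto)
  finally show R1Psi: "R1 * \<Psi> = E * \<Psi> * J"
    unfolding R1 using M Jd by (simp add: mult_assoc_dim)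
  show "E + R1 * \<Psi> * H = R1"
    unfolding R1Psi unfolding R1 M_def
    by (rule eq_matI) (use Jd in \<open>auto simp: mat_expand simp del: index_mult_mat(1)\<close>)
qed

text \<open>Multiplication by \<open>up\<close> retains only the first block row of the triangular
  factor, so the product factors through dimension \<open>np\<close>. Exchanging the two factors
  cancels \<open>K\<close> and leaves \<open>E + X * H\<close>.\<close>

lemma spectral_radius_R:
  assumes np: "np > 0" and X: "X \<in> carrier_mat np nm"
    and J: "J \<in> carrier_mat nm nm"
  shows "spectral_radius (map_mat complex_of_real
      (K * up * four_block_mat (1\<^sub>m np) X (0\<^sub>m nm np) J * minv K))
    = spectral_radius (map_mat complex_of_real (E + X * H))"
proof -
  \<comment> \<open>The empty blocks allow the rectangular factors \<open>[E; H]\<close> and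
    \<open>[I, X]\<close> to be multiplied as block matrices.\<close>
  define P where "P = four_block_mat E (0\<^sub>m np 0) H (0\<^sub>m nm 0)"
  define Q where "Q = four_block_mat (1\<^sub>m np) X (0\<^sub>m 0 np) (0\<^sub>m 0 nm)"
  have P: "P \<in> carrier_mat dim np" and Q: "Q \<in> carrier_mat np dim"
    using X by (auto simp: P_def Q_def)
  note c = K_carrier up_carrier inverse_K(1) P Q
  let ?V = "four_block_mat (1\<^sub>m np) X (0\<^sub>m nm np) J"
  have V: "?V \<in> carrier_mat dim dim" using J by auto
  have upV: "up * ?V = four_block_mat E (E * X) H (H * X)"
    unfolding up_def
    by (subst mult_four_block_mat[OF E_carrier zero_carrier_mat H_carrier zero_carrier_mat
          one_carrier_mat X zero_carrier_mat J])
      (use X J in \<open>simp add: add_zero_dim\<close>)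
  have PQ: "P * Q = four_block_mat E (E * X) H (H * X)"
    unfolding P_def Q_def
    by (subst mult_four_block_mat[OF E_carrier zero_carrier_mat H_carrier zero_carrier_mat
          one_carrier_mat X zero_carrier_mat zero_carrier_mat])
      (use X in \<open>simp add: add_zero_dim\<close>)
  have "Q * P = four_block_mat (E + X * H) (0\<^sub>m np 0) (0\<^sub>m 0 np) (0\<^sub>m 0 0)"
    unfolding P_def Q_def
    by (subst mult_four_block_mat[OF one_carrier_mat X zero_carrier_mat zero_carrier_mat
          E_carrier zero_carrier_mat H_carrier zero_carrier_mat])
      (use X in \<open>simp add: add_zero_dim\<close>)
  also have "\<dots> = E + X * H" by (rule eq_matI) (use X in auto)
  finally have QP: "Q * P = E + X * H" .
  have "K * up * ?V * minv K = K * (up * ?V) * minv K" using c V by (simp add: mult_assoc_dim)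
  also have "\<dots> = (K * P) * (Q * minv K)" unfolding upV PQ[symmetric] using c by (simp add: mult_assoc_dim)
  finally have fact: "K * up * ?V * minv K = (K * P) * (Q * minv K)" .
  have KP: "K * P \<in> carrier_mat dim np" and QK: "Q * minv K \<in> carrier_mat np dim" using c by auto
  have "(Q * minv K) * (K * P) = Q * (minv K * K) * P" using c by (simp add: mult_assoc_dim)
  then have swap: "(Q * minv K) * (K * P) = E + X * H" using c by (simp add: inverse_K QP)
  let ?c = "map_mat complex_of_real"
  have "spectral_radius (?c ((K * P) * (Q * minv K))) = spectral_radius (?c (K * P) * ?c (Q * minv K))"
    by (simp only: of_real_hom.mat_hom_mult[OF KP QK])
  also have "\<dots> = spectral_radius (?c (Q * minv K) * ?c (K * P))"
    by (rule spectral_radius_mult_commute[of _ dim np]) (use KP QK np in auto)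
  also have "\<dots> = spectral_radius (?c (E + X * H))"
    by (simp only: of_real_hom.mat_hom_mult[OF QK KP, symmetric] swap)
  finally show ?thesis unfolding fact .
qed

section \<open>Matching with the transition blocks of the QBD\<close>

lemma uniformised_blocks:
  assumes "split_block (1\<^sub>m dim + k \<cdot>\<^sub>m T) np np = (A, B, C, D)"
  shows "A = 1\<^sub>m np + k \<cdot>\<^sub>m Tpp" "B = k \<cdot>\<^sub>m Tpm" "C = k \<cdot>\<^sub>m Tmp" "D = 1\<^sub>m nm + k \<cdot>\<^sub>m Tmm"
proof -
  have s: "A \<in> carrier_mat np np" "B \<in> carrier_mat np nm" "C \<in> carrier_mat nm np" "D \<in> carrier_mat nm nm"
    "1\<^sub>m dim + k \<cdot>\<^sub>m T = four_block_mat A B C D"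
    using split_block[OF assms, of nm nm] T_carrier by auto
  have eq: "four_block_mat A B C D
      = four_block_mat (1\<^sub>m np + k \<cdot>\<^sub>m Tpp) (k \<cdot>\<^sub>m Tpm) (k \<cdot>\<^sub>m Tmp) (1\<^sub>m nm + k \<cdot>\<^sub>m Tmm)"
    unfolding s(5)[symmetric] by (subst T_eq) (rule eq_matI, auto)
  have c: "1\<^sub>m np + k \<cdot>\<^sub>m Tpp \<in> carrier_mat np np" "k \<cdot>\<^sub>m Tpm \<in> carrier_mat np nm"
    "k \<cdot>\<^sub>m Tmp \<in> carrier_mat nm np" "1\<^sub>m nm + k \<cdot>\<^sub>m Tmm \<in> carrier_mat nm nm" by auto
  show "A = 1\<^sub>m np + k \<cdot>\<^sub>m Tpp" "B = k \<cdot>\<^sub>m Tpm" "C = k \<cdot>\<^sub>m Tmp" "D = 1\<^sub>m nm + k \<cdot>\<^sub>m Tmm"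
    using four_block_mat_eqD[OF eq s(1-4) c] by auto
qed

lemma one_minus_K_block:
  "1\<^sub>m dim - K = (1 / 2) \<cdot>\<^sub>m four_block_mat (1\<^sub>m np + (1 / mu) \<cdot>\<^sub>m Tpp) ((1 / lam) \<cdot>\<^sub>m Tpm)
    ((1 / mu) \<cdot>\<^sub>m Tmp) (1\<^sub>m nm + (1 / lam) \<cdot>\<^sub>m Tmm)"
  unfolding K_def den_def by (rule eq_matI) (auto simp: field_simps)

lemma K_up_block:
  "K * up = (1 / 2) \<cdot>\<^sub>m four_block_mat (1\<^sub>m np + (1 / lam) \<cdot>\<^sub>m Tpp) (0\<^sub>m np nm)
    ((1 / lam) \<cdot>\<^sub>m Tmp) (0\<^sub>m nm nm)"
  unfolding K_up num_def
  by (subst mult_four_block_mat[of _ np np _ nm _ nm _ _ np _ nm]) (auto simp: add_zero_dim)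

lemma K_down_block:
  "K * down = (1 / 2) \<cdot>\<^sub>m four_block_mat (0\<^sub>m np np) ((1 / mu) \<cdot>\<^sub>m Tpm)
    (0\<^sub>m nm np) (1\<^sub>m nm + (1 / mu) \<cdot>\<^sub>m Tmm)"
  unfolding K_down num_def
  by (subst mult_four_block_mat[of _ np np _ nm _ nm _ _ np _ nm]) (auto simp: add_zero_dim)

end

theorem theorem8:
  fixes np nm :: nat and T Tpp Tpm Tmp Tmm \<Psi> :: "real mat" and lam mu :: real
    and Plam Pmu Plampp Plampm Plammp Plammm Pmupp Pmupm Pmump Pmumm E G H F R1 Cm1 C0 C1 RC :: "real mat"
  assumes np: "np > 0" and nm: "nm > 0"
    and gen: "generator_mat (np + nm) T"
    and Tblocks: "split_block T np np = (Tpp, Tpm, Tmp, Tmm)"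
    and Psi: "min_nonneg_sol np nm
               (\<lambda>X. Tpm + X * Tmm + Tpp * X + X * Tmp * X = 0\<^sub>m np nm) \<Psi>"
    and lam: "lam > 0" "\<forall>i < np + nm. \<bar>T $$ (i,i)\<bar> \<le> lam"
    and mu_pos: "mu > 0" "\<forall>i < np + nm. \<bar>T $$ (i,i)\<bar> \<le> mu"
    and Plam_def: "Plam = 1\<^sub>m (np + nm) + (1 / lam) \<cdot>\<^sub>m T"
    and Pmu_def: "Pmu = 1\<^sub>m (np + nm) + (1 / mu) \<cdot>\<^sub>m T"
    and Plamblocks: "split_block Plam np np = (Plampp, Plampm, Plammp, Plammm)"
    and Pmublocks: "split_block Pmu np np = (Pmupp, Pmupm, Pmump, Pmumm)"
    and EGHF: "split_block
       (minv (four_block_mat (1\<^sub>m np - (1 / mu) \<cdot>\<^sub>m Tpp) (- ((1 / lam) \<cdot>\<^sub>m Tpm))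
                             (- ((1 / mu) \<cdot>\<^sub>m Tmp)) (1\<^sub>m nm - (1 / lam) \<cdot>\<^sub>m Tmm))
        * four_block_mat (1\<^sub>m np + (1 / lam) \<cdot>\<^sub>m Tpp) ((1 / mu) \<cdot>\<^sub>m Tpm)
                         ((1 / lam) \<cdot>\<^sub>m Tmp) (1\<^sub>m nm + (1 / mu) \<cdot>\<^sub>m Tmm)) np np = (E, G, H, F)"
    and R1_def: "R1 = E * minv (1\<^sub>m np - \<Psi> * H)"
    and Cm1_def: "Cm1 = (1 / 2) \<cdot>\<^sub>m four_block_mat (0\<^sub>m np np) Pmupm (0\<^sub>m nm np) Pmumm"
    and C0_def: "C0 = (1 / 2) \<cdot>\<^sub>m four_block_mat Pmupp Plampm Pmump Plammm"
    and C1_def: "C1 = (1 / 2) \<cdot>\<^sub>m four_block_mat Plampp (0\<^sub>m np nm) Plammp (0\<^sub>m nm nm)"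
    and RC: "min_nonneg_sol (np + nm) (np + nm) (\<lambda>R. R * R * Cm1 + R * C0 + C1 = R) RC"
  shows "RC = (1\<^sub>m (np + nm) - C0) * four_block_mat E (0\<^sub>m np nm) H (0\<^sub>m nm nm)
              * four_block_mat (1\<^sub>m np) (R1 * \<Psi>) (0\<^sub>m nm np) (minv (1\<^sub>m nm - H * \<Psi>))
              * minv (1\<^sub>m (np + nm) - C0)
         \<and> spectral_radius (map_mat complex_of_real RC) = spectral_radius (map_mat complex_of_real R1)"
proof -
  interpret fluid_queue np nm T Tpp Tpm Tmp Tmm \<Psi> E G H F lam mu
    by (rule fluid_queue.intro[OF gen Tblocks Psi lam mu_pos EGHF])
  note P_blocks = uniformised_blocks[OF Plamblocks[unfolded Plam_def]]
    uniformised_blocks[OF Pmublocks[unfolded Pmu_def]]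
  have C0: "C0 = 1\<^sub>m (np + nm) - K" and C1: "C1 = K * up" and Cm1: "Cm1 = K * down"
    unfolding C0_def C1_def Cm1_def P_blocks one_minus_K_block K_up_block K_down_block by simp_all
  have K: "1\<^sub>m (np + nm) - C0 = K"
    unfolding C0 by (rule eq_matI) (use K_carrier in auto)
  obtain J where J: "J \<in> carrier_mat nm nm" "(1\<^sub>m nm - H * \<Psi>) * J = 1\<^sub>m nm"
    "J * (1\<^sub>m nm - H * \<Psi>) = 1\<^sub>m nm" "nonneg_mat J"
    by (rule inverse_one_minus_H_Psi)
  have minv_J: "minv (1\<^sub>m nm - H * \<Psi>) = J"
    by (rule minv_eqI[OF _ J(1-3)]) auto
  note R1 = inverse_one_minus_Psi_H[OF J(1-3), folded R1_def]
  have RC_eq: "RC = K * up * four_block_mat (1\<^sub>m np) (R1 * \<Psi>) (0\<^sub>m nm np) J * minv K"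
    unfolding R1(2) by (rule minimal_R_eq[OF RC[unfolded C0 C1 Cm1] J])
  have "R1 * \<Psi> \<in> carrier_mat np nm" by (rule mult_carrier_mat[OF R1(1) Psi_carrier])
  \<comment> \<open>Used at \<open>X = R1 * \<Psi>\<close>, where \<open>E + X * H\<close> collapses
    to \<open>R1\<close>.\<close>
  from spectral_radius_R[OF np this J(1)]
  have "spectral_radius (map_mat complex_of_real RC) = spectral_radius (map_mat complex_of_real R1)"
    unfolding RC_eq R1(3) .
  with RC_eq show ?thesis unfolding K minv_J up_def by (rule conjI)
qed

end
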